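(* Let $E$ be a symmetric space on $I$. If $x\in E$ is a point of order continuity and a ULUKM point of $E$, then $|x|$ is a ULUM point of $E$ and $x$ is an $H_g$ point of $E$.
   Context: Let $I=[0,\alpha)$ with $\alpha=1$ or $\alpha=\infty$, with Lebesgue measure $\mu$, and let $L^0$ be the set of (equivalence classes of) extended real valued measurable functions on $I$. A Banach function space $(E,\|\cdot\|_E)$ is a Banach lattice that is a sublattice of $L^0$ such that (1) $x\in L^0$, $y\in E$, $|x|\le|y|$ a.e. imply $x\in E$ and $\|x\|_E\le\|y\|_E$; (2) $E$ contains a strictly positive function. $E^+=\{x\in E:x\ge0\}$. For $x\in L^0$: $d_x(\lambda)=\mu\{s\in I:|x(s)|>\lambda\}$, $x^*(t)=\inf\{\lambda>0:d_x(\lambda)\le t\}$, $x^{**}(t)=\frac1t\int_0^t x^*(s)\,ds$. $E$ is symmetric if $x\in L^0$, $y\in E$, $d_x=d_y$ imply $x\in E$ and $\|x\|_E=\|y\|_E$. Standing assumption: $E$ has the Fatou property, i.e. if $(x_n)\subset E^+$, $\sup_n\|x_n\|_E<\infty$ and $x_n\uparrow x\in L^0$, then $x\in E$ and $\|x_n\|_E\uparrow\|x\|_E$. For $x,y\in L^1+L^\infty$, $x\prec y$ means $x^{**}(t)\le y^{**}(t)$ for all $t>0$. $x\in E$ is a point of order continuity if for every $(x_n)\subset E^+$ with $x_n\le|x|$ and $x_n\to0$ a.e. we have $\|x_n\|_E\to0$. $x\in E$ is a ULUKM point (point of upper local uniform $K$-monotonicity) if for every $(x_n)\subset E$ with $x\prec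 x_n$ for all $n$ and $\|x_n\|_E\to\|x\|_E$ we have $\|x^*-x_n^*\|_E\to0$. $y\in E^+$ is a ULUM point (point of upper local uniform monotonicity) if for every $(x_n)\subset E$ with $y\le x_n$ for all $n$ and $\|x_n\|_E\to\|y\|_E$ we have $\|x_n-y\|_E\to0$. $x\in E$ is an $H_g$ point if for every $(x_n)\subset E$ with $x_n\to x$ globally in measure (i.e. $\mu\{|x_n-x|>\epsilon\}\to0$ for all $\epsilon>0$) and $\|x_n\|_E\to\|x\|_E$ we have $\|x_n-x\|_E\to0$. *)

theory Defs
  imports "HOL-Analysis.Analysis"
begin

text \<open>
  Elements of \<open>L\<^sup>0\<close> are represented by measurable functions into \<^typ>\<open>ereal\<close>; only their values
  on \<open>I = [0, \<alpha>)\<close> up to null sets matter. A function space is a set \<open>E\<close> of such representatives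
  with a norm \<open>N\<close>. The ideal property below makes \<open>E\<close> and \<open>N\<close> invariant under almost everywhere
  equality.
\<close>

definition leb_I :: "ereal \<Rightarrow> real measure" where
  "leb_I \<alpha> = lebesgue_on {t. 0 \<le> t \<and> ereal t < \<alpha>}"

definition L0 :: "ereal \<Rightarrow> (real \<Rightarrow> ereal) set" where
  "L0 \<alpha> = borel_measurable (leb_I \<alpha>)"

text \<open>
  The condition \<open>AE_finite\<close> is what makes pointwise addition meaningful on almost everywhere
  classes; it excludes nothing, since a function in \<open>E\<close> that is infinite on a set \<open>A\<close> of positive
  measure would give \<open>z = \<infinity> \<cdot> 1\<^sub>A\<close> in \<open>E\<close> with \<open>2 z = z \<noteq> 0\<close>. On the remaining null sets the
  convention for \<open>\<infinity> - \<infinity>\<close> is irrelevant.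
\<close>

locale banach_function_space =
  fixes \<alpha> :: ereal and E :: "(real \<Rightarrow> ereal) set" and N :: "(real \<Rightarrow> ereal) \<Rightarrow> real"
  assumes alpha: "\<alpha> = 1 \<or> \<alpha> = \<infinity>"
    and subset_L0: "E \<subseteq> L0 \<alpha>"
    and AE_finite: "x \<in> E \<Longrightarrow> AE t in leb_I \<alpha>. \<bar>x t\<bar> \<noteq> \<infinity>"
    and add_closed: "\<lbrakk>x \<in> E; y \<in> E\<rbrakk> \<Longrightarrow> (\<lambda>t. x t + y t) \<in> E"
    and scale_closed: "x \<in> E \<Longrightarrow> (\<lambda>t. ereal c * x t) \<in> E"
    and sup_closed: "\<lbrakk>x \<in> E; y \<in> E\<rbrakk> \<Longrightarrow> (\<lambda>t. max (x t) (y t)) \<in> E"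
    and inf_closed: "\<lbrakk>x \<in> E; y \<in> E\<rbrakk> \<Longrightarrow> (\<lambda>t. min (x t) (y t)) \<in> E"
    and norm_nonneg: "x \<in> E \<Longrightarrow> 0 \<le> N x"
    and norm_zero_iff: "x \<in> E \<Longrightarrow> N x = 0 \<longleftrightarrow> (AE t in leb_I \<alpha>. x t = 0)"
    and norm_scale: "x \<in> E \<Longrightarrow> N (\<lambda>t. ereal c * x t) = \<bar>c\<bar> * N x"
    and norm_triangle: "\<lbrakk>x \<in> E; y \<in> E\<rbrakk> \<Longrightarrow> N (\<lambda>t. x t + y t) \<le> N x + N y"
    and complete: "\<lbrakk>\<And>n. X n \<in> E;
        \<forall>e>0. \<exists>M::nat. \<forall>m\<ge>M. \<forall>n\<ge>M. N (\<lambda>t. X m t - X n t) < e\<rbrakk>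
      \<Longrightarrow> \<exists>x\<in>E. (\<lambda>n. N (\<lambda>t. X n t - x t)) \<longlonglongrightarrow> 0"
    and ideal: "\<lbrakk>x \<in> L0 \<alpha>; y \<in> E; AE t in leb_I \<alpha>. \<bar>x t\<bar> \<le> \<bar>y t\<bar>\<rbrakk> \<Longrightarrow> x \<in> E \<and> N x \<le> N y"
    and strictly_positive: "\<exists>w\<in>E. AE t in leb_I \<alpha>. 0 < w t"

definition pos_cone :: "ereal \<Rightarrow> (real \<Rightarrow> ereal) set \<Rightarrow> (real \<Rightarrow> ereal) set" where
  "pos_cone \<alpha> E = {x \<in> E. AE t in leb_I \<alpha>. 0 \<le> x t}"

definition distr_fun :: "ereal \<Rightarrow> (real \<Rightarrow> ereal) \<Rightarrow> real \<Rightarrow> ennreal" where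
  "distr_fun \<alpha> x l = emeasure (leb_I \<alpha>) {s \<in> space (leb_I \<alpha>). ereal l < \<bar>x s\<bar>}"

text \<open>The infimum is taken in \<^typ>\<open>ereal\<close>, so that it is \<open>\<infinity>\<close> for the empty set. For \<open>\<alpha> = 1\<close> the
  formula also covers \<open>t \<ge> 1\<close>, where it gives \<open>0\<close>.\<close>

definition decr_rearr :: "ereal \<Rightarrow> (real \<Rightarrow> ereal) \<Rightarrow> real \<Rightarrow> ereal" where
  "decr_rearr \<alpha> x t = Inf {ereal l |l. 0 < l \<and> distr_fun \<alpha> x l \<le> ennreal t}"

definition maximal_fun :: "ereal \<Rightarrow> (real \<Rightarrow> ereal) \<Rightarrow> real \<Rightarrow> ennreal" where
  "maximal_fun \<alpha> x t = (\<integral>\<^sup>+s\<in>{0..t}. e2ennreal (decr_rearr \<alpha> x s) \<partial>lborel) / ennreal t"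

text \<open>The relation \<open>x \<prec> y\<close>. As the maximal function takes values in \<^typ>\<open>ennreal\<close>, the
  relation makes sense on all of \<open>L\<^sup>0\<close>. It is used only on symmetric spaces, which are contained
  in \<open>L\<^sup>1 + L\<^sup>\<infinity>\<close>.\<close>

definition submajorized :: "ereal \<Rightarrow> (real \<Rightarrow> ereal) \<Rightarrow> (real \<Rightarrow> ereal) \<Rightarrow> bool" where
  "submajorized \<alpha> x y \<longleftrightarrow> (\<forall>t>0. maximal_fun \<alpha> x t \<le> maximal_fun \<alpha> y t)"

locale symmetric_space = banach_function_space +
  assumes symmetric: "\<lbrakk>x \<in> L0 \<alpha>; y \<in> E; distr_fun \<alpha> x = distr_fun \<alpha> y\<rbrakk> \<Longrightarrow> x \<in> E \<and> N x = N y"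

definition fatou_property ::
  "ereal \<Rightarrow> (real \<Rightarrow> ereal) set \<Rightarrow> ((real \<Rightarrow> ereal) \<Rightarrow> real) \<Rightarrow> bool" where
  "fatou_property \<alpha> E N \<longleftrightarrow>
    (\<forall>X x. (\<forall>n::nat. X n \<in> pos_cone \<alpha> E) \<and> bdd_above (range (\<lambda>n. N (X n))) \<and> x \<in> L0 \<alpha> \<and>
        (AE t in leb_I \<alpha>. incseq (\<lambda>n. X n t) \<and> (\<lambda>n. X n t) \<longlonglongrightarrow> x t)
      \<longrightarrow> x \<in> E \<and> incseq (\<lambda>n. N (X n)) \<and> (\<lambda>n. N (X n)) \<longlonglongrightarrow> N x)"

definition oc_point ::
  "ereal \<Rightarrow> (real \<Rightarrow> ereal) set \<Rightarrow> ((real \<Rightarrow> ereal) \<Rightarrow> real) \<Rightarrow> (real \<Rightarrow> ereal) \<Rightarrow> bool" where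
  "oc_point \<alpha> E N x \<longleftrightarrow> x \<in> E \<and>
    (\<forall>X. (\<forall>n::nat. X n \<in> pos_cone \<alpha> E) \<and> (\<forall>n. AE t in leb_I \<alpha>. X n t \<le> \<bar>x t\<bar>) \<and>
        (AE t in leb_I \<alpha>. (\<lambda>n. X n t) \<longlonglongrightarrow> 0)
      \<longrightarrow> (\<lambda>n. N (X n)) \<longlonglongrightarrow> 0)"

definition ulukm_point ::
  "ereal \<Rightarrow> (real \<Rightarrow> ereal) set \<Rightarrow> ((real \<Rightarrow> ereal) \<Rightarrow> real) \<Rightarrow> (real \<Rightarrow> ereal) \<Rightarrow> bool" where
  "ulukm_point \<alpha> E N x \<longleftrightarrow> x \<in> E \<and>
    (\<forall>X. (\<forall>n::nat. X n \<in> E) \<and> (\<forall>n. submajorized \<alpha> x (X n)) \<and> (\<lambda>n. N (X n)) \<longlonglongrightarrow> N x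
      \<longrightarrow> (\<lambda>n. N (\<lambda>t. decr_rearr \<alpha> x t - decr_rearr \<alpha> (X n) t)) \<longlonglongrightarrow> 0)"

definition ulum_point ::
  "ereal \<Rightarrow> (real \<Rightarrow> ereal) set \<Rightarrow> ((real \<Rightarrow> ereal) \<Rightarrow> real) \<Rightarrow> (real \<Rightarrow> ereal) \<Rightarrow> bool" where
  "ulum_point \<alpha> E N y \<longleftrightarrow> y \<in> pos_cone \<alpha> E \<and>
    (\<forall>X. (\<forall>n::nat. X n \<in> E) \<and> (\<forall>n. AE t in leb_I \<alpha>. y t \<le> X n t) \<and> (\<lambda>n. N (X n)) \<longlonglongrightarrow> N y
      \<longrightarrow> (\<lambda>n. N (\<lambda>t. X n t - y t)) \<longlonglongrightarrow> 0)"

definition converges_globally_in_measure ::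
  "ereal \<Rightarrow> (nat \<Rightarrow> real \<Rightarrow> ereal) \<Rightarrow> (real \<Rightarrow> ereal) \<Rightarrow> bool" where
  "converges_globally_in_measure \<alpha> X x \<longleftrightarrow>
    (\<forall>e>0. (\<lambda>n. emeasure (leb_I \<alpha>) {t \<in> space (leb_I \<alpha>). ereal e < \<bar>X n t - x t\<bar>}) \<longlonglongrightarrow> 0)"

definition hg_point ::
  "ereal \<Rightarrow> (real \<Rightarrow> ereal) set \<Rightarrow> ((real \<Rightarrow> ereal) \<Rightarrow> real) \<Rightarrow> (real \<Rightarrow> ereal) \<Rightarrow> bool" where
  "hg_point \<alpha> E N x \<longleftrightarrow> x \<in> E \<and>
    (\<forall>X. (\<forall>n. X n \<in> E) \<and> converges_globally_in_measure \<alpha> X x \<and> (\<lambda>n. N (X n)) \<longlonglongrightarrow> N x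
      \<longrightarrow> (\<lambda>n. N (\<lambda>t. X n t - x t)) \<longlonglongrightarrow> 0)"

end

theory Submission
  imports Defs
begin

text \<open>
  Let \<open>u \<ge> \<bar>x\<bar>\<close> and \<open>g = x\<^sup>* - u\<^sup>*\<close>. By the ULUKM property, \<open>N g\<close> is small once \<open>N u\<close> is close to
  \<open>N x\<close>. For a finite grid \<open>L\<close> with spacing \<open>\<delta> \<eta>\<close> reaching from \<open>\<eta>\<close> to \<open>K\<close>,
  \<open>u - \<bar>x\<bar> \<le> min u \<eta> + 2 (u - K/2)\<^sup>+ + \<delta> \<bar>x\<bar> + K \<cdot> 1\<^sub>B\<close>, where \<open>B\<close> is the set on which some
  \<open>a \<in> L\<close> satisfies \<open>\<bar>x\<bar> < a \<le> u\<close>. The first two functions are equimeasurable with the same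
  truncations of \<open>u\<^sup>*\<close>, which exceed those of \<open>x\<^sup>*\<close> by at most \<open>\<bar>g\<bar>\<close>; the truncations of \<open>x\<close> have
  small norm by order continuity. The sets \<open>{\<bar>x\<bar> \<le> b < u}\<close> and \<open>{x\<^sup>* \<le> b < u\<^sup>*}\<close> have equal measure,
  and on the latter either \<open>\<bar>g\<bar>\<close> is bounded below or \<open>x\<^sup>*\<close> lies in a thin level strip, whose
  indicator again has small norm by order continuity. This gives the ULUM property of \<open>\<bar>x\<bar>\<close>.

  If \<open>x\<^sub>n \<rightarrow> x\<close> in measure and \<open>N x\<^sub>n \<rightarrow> N x\<close>, then \<open>(\<bar>x\<bar> - \<bar>x\<^sub>n\<bar>)\<^sup>+ \<rightarrow> 0\<close> in norm by order continuity,
  hence \<open>N (max \<bar>x\<^sub>n\<bar> \<bar>x\<bar>) \<rightarrow> N x\<close> and the ULUM property applies to \<open>max \<bar>x\<^sub>n\<bar> \<bar>x\<bar>\<close>.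
\<close>

section \<open>Lebesgue measure on \<open>I\<close> and on its initial segments\<close>

lemma space_leb_I: "space (leb_I \<alpha>) = {t. 0 \<le> t \<and> ereal t < \<alpha>}"
  by (simp add: leb_I_def)

lemma is_interval_ereal_less: "is_interval {t. 0 \<le> t \<and> ereal t < a}"
  unfolding is_interval_1 by (auto intro: le_less_trans[of "ereal _" "ereal _" a])

lemma sets_leb_I_interval: "is_interval A \<Longrightarrow> A \<inter> space (leb_I \<alpha>) \<in> sets (leb_I \<alpha>)"
proof -
  assume "is_interval A"
  moreover have "{t. 0 \<le> t \<and> ereal t < \<alpha>} \<in> sets lebesgue"
    using real_interval_borel_measurable[OF is_interval_ereal_less] by auto
  ultimately show ?thesis
    using real_interval_borel_measurable[of A]
    unfolding space_leb_I leb_I_def by (auto simp: sets_restrict_space_iff)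
qed

text \<open>Level sets of a decreasing rearrangement are initial segments of \<open>I\<close>, and
  their measure is read off here. The bound on \<open>c\<close> keeps the segment inside
  \<open>I\<close>; \<open>c = top\<close> is included for level sets of infinite measure.\<close>

lemma emeasure_leb_I_initial:
  assumes "c \<le> e2ennreal \<alpha>" "0 \<le> \<alpha>"
  shows "emeasure (leb_I \<alpha>) {t \<in> space (leb_I \<alpha>). ennreal t < c} = c"
proof -
  have I: "{t. 0 \<le> t \<and> ereal t < \<alpha>} \<in> sets lebesgue"
    using real_interval_borel_measurable[OF is_interval_ereal_less] by auto
  have "{t \<in> space (leb_I \<alpha>). ennreal t < c} = {t. 0 \<le> t \<and> ennreal t < c}"
  proof -
    have "ereal t < \<alpha>" if "0 \<le> t" "ennreal t < c" for t
    proof -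
      have "ennreal t < e2ennreal \<alpha>"
        using that assms(1) by simp
      then show ?thesis
        using that(1) assms(2)
        by (cases \<alpha>) (auto simp: ennreal_less_iff)
    qed
    then show ?thesis
      by (auto simp: space_leb_I)
  qed
  moreover have "emeasure (leb_I \<alpha>) {t \<in> space (leb_I \<alpha>). ennreal t < c}
      = emeasure lebesgue {t \<in> space (leb_I \<alpha>). ennreal t < c}"
    unfolding space_leb_I unfolding leb_I_def
    using I by (subst emeasure_restrict_space) auto
  moreover have "emeasure lebesgue {t. 0 \<le> t \<and> ennreal t < c} = c"
  proof (cases c)
    case (real r)
    then have "{t. 0 \<le> t \<and> ennreal t < c} = {0..<r}"
      by (auto simp: ennreal_less_iff)
    then show ?thesis
      using real by simp
  next
    case top
    then have "{t. 0 \<le> t \<and> ennreal t < c} = {0..}"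
      by auto
    moreover have "ennreal (real n) \<le> emeasure lebesgue {0::real..}" for n
      using emeasure_mono[of "{0..real n}" "{0..}" lebesgue] by simp
    then have "emeasure lebesgue {0::real..} = top"
      using ennreal_Ex_less_of_nat[of "emeasure lebesgue {0::real..}"]
      by (metis ennreal_of_nat_eq_real_of_nat infinity_ennreal_def less_top not_le)
    ultimately show ?thesis
      using top by simp
  qed
  ultimately show ?thesis
    by simp
qed

lemma emeasure_leb_I_space:
  assumes "0 \<le> \<alpha>"
  shows "emeasure (leb_I \<alpha>) (space (leb_I \<alpha>)) = e2ennreal \<alpha>"
proof -
  have "{t \<in> space (leb_I \<alpha>). ennreal t < e2ennreal \<alpha>} = space (leb_I \<alpha>)"
    using assms unfolding space_leb_I by (cases \<alpha>) (auto simp: ennreal_less_iff)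
  then show ?thesis
    using emeasure_leb_I_initial[of "e2ennreal \<alpha>" \<alpha>] assms by simp
qed

section \<open>Distribution functions and decreasing rearrangements\<close>

lemma sets_gt_abs: "x \<in> L0 \<alpha> \<Longrightarrow> {s \<in> space (leb_I \<alpha>). c < \<bar>x s\<bar>} \<in> sets (leb_I \<alpha>)"
  unfolding L0_def by measurable

lemma distr_fun_antimono:
  assumes "x \<in> L0 \<alpha>" "l \<le> m"
  shows "distr_fun \<alpha> x m \<le> distr_fun \<alpha> x l"
  unfolding distr_fun_def
  using assms le_less_trans[of "ereal l" "ereal m"]
  by (intro emeasure_mono sets_gt_abs) auto

lemma distr_fun_mono:
  assumes "y \<in> L0 \<alpha>" "AE t in leb_I \<alpha>. \<bar>x t\<bar> \<le> \<bar>y t\<bar>"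
  shows "distr_fun \<alpha> x l \<le> distr_fun \<alpha> y l"
  unfolding distr_fun_def
  by (intro emeasure_mono_AE sets_gt_abs assms(1) eventually_mono[OF assms(2)]) auto

text \<open>Continuity of the measure from below: the level sets above \<open>l + 1 / Suc n\<close>
  increase to the one above \<open>l\<close>. The phrasing with a lower bound \<open>c\<close>
  covers infinite values as well.\<close>

lemma distr_fun_right_continuous:
  assumes "x \<in> L0 \<alpha>" "c < distr_fun \<alpha> x l"
  shows "\<exists>m>l. c < distr_fun \<alpha> x m"
proof -
  define A where "A m = {s \<in> space (leb_I \<alpha>). ereal m < \<bar>x s\<bar>}" for m
  let ?B = "\<lambda>n::nat. A (l + 1 / Suc n)"
  have A_antimono: "A m' \<subseteq> A m" if "m \<le> m'" for m m'
    unfolding A_def using le_less_trans[of "ereal m" "ereal m'"] that by auto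
  have "A l \<subseteq> (\<Union>n. ?B n)"
  proof
    fix s assume s: "s \<in> A l"
    then obtain r where r: "l < r" "ereal r < \<bar>x s\<bar>"
      using ereal_dense2[of "ereal l" "\<bar>x s\<bar>"] by (auto simp: A_def)
    then obtain n where n: "1 / Suc n < r - l"
      using nat_approx_posE[of "r - l"] by auto
    have "s \<in> A r"
      using s r(2) by (simp add: A_def)
    also have "A r \<subseteq> ?B n"
      using n by (intro A_antimono) simp
    finally show "s \<in> (\<Union>n. ?B n)"
      by blast
  qed
  moreover have "(\<Union>n. ?B n) \<subseteq> A l"
    by (intro UN_least A_antimono) simp
  ultimately have "(\<Union>n. ?B n) = A l"
    by (rule subset_antisym[rotated])
  moreover have "incseq ?B"
    by (intro incseq_SucI A_antimono) (simp add: frac_le)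
  moreover have "range ?B \<subseteq> sets (leb_I \<alpha>)"
    unfolding A_def using sets_gt_abs[OF assms(1)] by blast
  ultimately have eq: "(SUP n. emeasure (leb_I \<alpha>) (?B n)) = emeasure (leb_I \<alpha>) (A l)"
    using SUP_emeasure_incseq[of ?B "leb_I \<alpha>"] by presburger
  obtain n where "c < emeasure (leb_I \<alpha>) (?B n)"
    using assms(2)[unfolded distr_fun_def, folded A_def, folded eq, unfolded less_SUP_iff] by blast
  then show ?thesis
    by (intro exI[of _ "l + 1 / Suc n"]) (simp add: distr_fun_def A_def)
qed

text \<open>The rearrangement is the generalized inverse of the distribution function, and right
  continuity of the latter makes both inequalities strict. Negative \<open>l\<close> must be
  excluded: the left side then always holds, the right side only while \<open>t\<close> is below the
  measure of \<open>I\<close>.\<close>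

lemma less_decr_rearr_iff:
  assumes "x \<in> L0 \<alpha>" "0 \<le> l"
  shows "ereal l < decr_rearr \<alpha> x t \<longleftrightarrow> ennreal t < distr_fun \<alpha> x l"
proof
  assume "ennreal t < distr_fun \<alpha> x l"
  then obtain m where m: "m > l" "ennreal t < distr_fun \<alpha> x m"
    using distr_fun_right_continuous[OF assms(1)] by blast
  have "ereal m \<le> decr_rearr \<alpha> x t"
    unfolding decr_rearr_def
  proof (rule Inf_greatest, clarsimp)
    fix k assume k: "distr_fun \<alpha> x k \<le> ennreal t"
    show "m \<le> k"
    proof (rule ccontr)
      assume "\<not> m \<le> k"
      then have "distr_fun \<alpha> x m \<le> distr_fun \<alpha> x k"
        by (intro distr_fun_antimono assms(1)) simp
      then show False
        using k m(2) by (metis leD order_trans)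
    qed
  qed
  then show "ereal l < decr_rearr \<alpha> x t"
    using m(1) order_less_le_trans[of "ereal l" "ereal m" "decr_rearr \<alpha> x t"] by simp
next
  assume l: "ereal l < decr_rearr \<alpha> x t"
  show "ennreal t < distr_fun \<alpha> x l"
  proof (rule ccontr)
    assume "\<not> ennreal t < distr_fun \<alpha> x l"
    then have d: "distr_fun \<alpha> x m \<le> ennreal t" if "m \<ge> l" for m
      using order_trans[OF distr_fun_antimono[OF assms(1) that], of "ennreal t"] by simp
    obtain m where m: "l < m" "ereal m < decr_rearr \<alpha> x t"
      using ereal_dense2[OF l] by auto
    have "decr_rearr \<alpha> x t \<le> ereal m"
      unfolding decr_rearr_def using m(1) assms(2) d[of m] by (intro Inf_lower) auto
    then show False
      using m(2) by simp
  qed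
qed

lemma decr_rearr_nonneg: "0 \<le> decr_rearr \<alpha> x t"
  unfolding decr_rearr_def by (rule Inf_greatest) auto

lemma decr_rearr_antimono:
  assumes "s \<le> t"
  shows "decr_rearr \<alpha> x t \<le> decr_rearr \<alpha> x s"
  unfolding decr_rearr_def
  by (intro Inf_superset_mono) (auto intro: order_trans[OF _ ennreal_leI[OF assms]])

lemma decr_rearr_mono:
  assumes "\<And>l. distr_fun \<alpha> x l \<le> distr_fun \<alpha> y l"
  shows "decr_rearr \<alpha> x t \<le> decr_rearr \<alpha> y t"
  unfolding decr_rearr_def
  by (intro Inf_superset_mono) (auto intro: order_trans[OF assms])

text \<open>By monotonicity every upper level set is an interval.\<close>

lemma decr_rearr_L0: "decr_rearr \<alpha> x \<in> L0 \<alpha>"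
  unfolding L0_def borel_measurable_ereal_iff_Ioi
proof
  fix a
  have "is_interval {t. a < decr_rearr \<alpha> x t}"
    using less_le_trans[OF _ decr_rearr_antimono, of a \<alpha> x] unfolding is_interval_1 mem_Collect_eq
    by blast
  then show "decr_rearr \<alpha> x -` {a<..} \<inter> space (leb_I \<alpha>) \<in> sets (leb_I \<alpha>)"
    using sets_leb_I_interval by (simp add: vimage_def)
qed

text \<open>The axiom \<open>symmetric\<close> compares distribution functions at every real level,
  so negative levels have to be settled too.\<close>

lemma distr_fun_neg: "l < 0 \<Longrightarrow> distr_fun \<alpha> x l = emeasure (leb_I \<alpha>) (space (leb_I \<alpha>))"
proof -
  assume "l < 0"
  then have "ereal l < \<bar>x s\<bar>" for s
    by (cases "x s") auto
  then show ?thesis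
    by (simp add: distr_fun_def)
qed

text \<open>By \<open>less_decr_rearr_iff\<close>, the level set of the rearrangement above
  \<open>l \<ge> 0\<close> is the initial segment of length
  \<open>distr_fun \<alpha> x l\<close>.\<close>

lemma distr_fun_decr_rearr:
  assumes "x \<in> L0 \<alpha>" "0 \<le> \<alpha>"
  shows "distr_fun \<alpha> (decr_rearr \<alpha> x) = distr_fun \<alpha> x"
proof
  fix l :: real
  show "distr_fun \<alpha> (decr_rearr \<alpha> x) l = distr_fun \<alpha> x l"
  proof (cases "l < 0")
    case True
    then show ?thesis by (simp add: distr_fun_neg)
  next
    case False
    have "distr_fun \<alpha> x l \<le> e2ennreal \<alpha>"
      unfolding emeasure_leb_I_space[OF assms(2), symmetric] distr_fun_def by (rule emeasure_space)
    then show ?thesis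
      using emeasure_leb_I_initial[of "distr_fun \<alpha> x l" \<alpha>] assms False
      by (simp add: distr_fun_def[of \<alpha> "decr_rearr \<alpha> x"] decr_rearr_nonneg less_decr_rearr_iff abs_ereal_ge0)
  qed
qed

section \<open>Submajorization, truncations and separation sets in terms of distribution
  functions\<close>

lemma submajorized_mono:
  assumes "y \<in> L0 \<alpha>" "AE t in leb_I \<alpha>. \<bar>x t\<bar> \<le> \<bar>y t\<bar>"
  shows "submajorized \<alpha> x y"
proof -
  have "decr_rearr \<alpha> x t \<le> decr_rearr \<alpha> y t" for t
    by (intro decr_rearr_mono distr_fun_mono assms)
  then show ?thesis
    unfolding submajorized_def maximal_fun_def
    by (auto intro!: divide_right_mono_ennreal nn_integral_mono mult_right_mono e2ennreal_mono)
qed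

text \<open>The right-hand side sees \<open>u\<close> only through its distribution function, so
  truncations of equimeasurable functions are again equimeasurable. \<open>distr_fun_excess\<close>
  serves the same end.\<close>

lemma distr_fun_min:
  assumes "0 \<le> \<eta>"
  shows "distr_fun \<alpha> (\<lambda>t. min \<bar>u t\<bar> (ereal \<eta>)) l =
    (if l < 0 then emeasure (leb_I \<alpha>) (space (leb_I \<alpha>)) else if l < \<eta> then distr_fun \<alpha> u l else 0)"
proof (cases "l < 0")
  case False
  have "\<bar>min \<bar>u t\<bar> (ereal \<eta>)\<bar> = min \<bar>u t\<bar> (ereal \<eta>)" for t
    using assms by (cases "u t") (auto simp: min_def)
  then show ?thesis
    using False by (simp add: distr_fun_def)
qed (simp add: distr_fun_neg)

lemma distr_fun_excess:
  "distr_fun \<alpha> (\<lambda>t. max (\<bar>u t\<bar> - ereal K) 0) l =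
    (if l < 0 then emeasure (leb_I \<alpha>) (space (leb_I \<alpha>)) else distr_fun \<alpha> u (l + K))"
proof (cases "l < 0")
  case False
  have "ereal l < \<bar>max (\<bar>u t\<bar> - ereal K) 0\<bar> \<longleftrightarrow> ereal (l + K) < \<bar>u t\<bar>" for t
    using False by (cases "u t") (auto simp: max_def zero_ereal_def)
  then show ?thesis
    using False by (simp add: distr_fun_def)
qed (simp add: distr_fun_neg)

lemma distr_fun_indicator:
  assumes "D \<subseteq> space (leb_I \<alpha>)"
  shows "distr_fun \<alpha> (indicator D) l = (if l < 0 then emeasure (leb_I \<alpha>) (space (leb_I \<alpha>))
    else if l < 1 then emeasure (leb_I \<alpha>) D else 0)"
proof (cases "l < 0")
  case False
  have "{s \<in> space (leb_I \<alpha>). ereal l < \<bar>indicator D s\<bar>} = (if l < 1 then D else {})"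
    using False assms by (auto simp: indicator_def zero_ereal_def one_ereal_def split: if_splits)
  then show ?thesis
    using False by (simp add: distr_fun_def)
qed (simp add: distr_fun_neg)

text \<open>Up to a null set the level set of \<open>x\<close> is contained in that of
  \<open>u\<close>, so this is the measure of a difference of nested sets. It is thus determined by
  two distribution functions and does not change when \<open>x\<close> and \<open>u\<close> are
  replaced by their rearrangements. Only the smaller set has to be of finite measure.\<close>

lemma emeasure_level_separation:
  assumes "x \<in> L0 \<alpha>" "u \<in> L0 \<alpha>" "AE t in leb_I \<alpha>. \<bar>x t\<bar> \<le> \<bar>u t\<bar>" "distr_fun \<alpha> x a \<noteq> \<infinity>"
  shows "emeasure (leb_I \<alpha>) {s \<in> space (leb_I \<alpha>). \<bar>x s\<bar> \<le> ereal a \<and> ereal a < \<bar>u s\<bar>}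
    = distr_fun \<alpha> u a - distr_fun \<alpha> x a"
proof -
  define U where "U = {s \<in> space (leb_I \<alpha>). ereal a < \<bar>u s\<bar>}"
  define A where "A = {s \<in> space (leb_I \<alpha>). ereal a < \<bar>x s\<bar>}"
  have sets: "U \<in> sets (leb_I \<alpha>)" "A \<in> sets (leb_I \<alpha>)"
    unfolding U_def A_def by (intro sets_gt_abs assms)+
  have "AE t in leb_I \<alpha>. t \<in> U \<inter> A \<longleftrightarrow> t \<in> A"
    using assms(3) by eventually_elim (auto simp: U_def A_def)
  then have eq: "emeasure (leb_I \<alpha>) (U \<inter> A) = emeasure (leb_I \<alpha>) A"
    by (rule emeasure_eq_AE) (use sets in auto)
  have "{s \<in> space (leb_I \<alpha>). \<bar>x s\<bar> \<le> ereal a \<and> ereal a < \<bar>u s\<bar>} = U - U \<inter> A"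
    by (auto simp: U_def A_def)
  also have "emeasure (leb_I \<alpha>) \<dots> = emeasure (leb_I \<alpha>) U - emeasure (leb_I \<alpha>) (U \<inter> A)"
    by (rule emeasure_Diff) (use sets assms(4) eq in \<open>auto simp: A_def distr_fun_def\<close>)
  finally show ?thesis
    unfolding eq by (simp add: distr_fun_def U_def A_def)
qed

lemma emeasure_leb_I_bounded: "emeasure (leb_I \<alpha>) {t \<in> space (leb_I \<alpha>). t < r} \<noteq> \<infinity>"
proof -
  have I: "{t. 0 \<le> t \<and> ereal t < \<alpha>} \<in> sets lebesgue"
    using real_interval_borel_measurable[OF is_interval_ereal_less] by auto
  have "emeasure (leb_I \<alpha>) {t \<in> space (leb_I \<alpha>). t < r}
      = emeasure lebesgue {t \<in> space (leb_I \<alpha>). t < r}"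
    unfolding space_leb_I unfolding leb_I_def
    using I by (subst emeasure_restrict_space) auto
  also have "\<dots> \<le> emeasure lebesgue {0..r}"
    by (rule emeasure_mono) (auto simp: space_leb_I)
  also have "\<dots> < \<infinity>"
    by (simp add: emeasure_lborel_Icc_eq)
  finally show ?thesis
    by simp
qed

section \<open>Norm estimates from the ideal property and from symmetry\<close>

context symmetric_space
begin

lemma alpha_nonneg: "0 \<le> \<alpha>"
  using alpha by auto

lemma E_measurable [measurable_dest]: "x \<in> E \<Longrightarrow> x \<in> borel_measurable (leb_I \<alpha>)"
  using subset_L0 by (auto simp: L0_def)

lemma E_L0: "x \<in> E \<Longrightarrow> x \<in> L0 \<alpha>"
  using subset_L0 by auto

lemma diff_closed: "f \<in> E \<Longrightarrow> g \<in> E \<Longrightarrow> (\<lambda>t. f t - g t) \<in> E"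
  using add_closed[OF _ scale_closed, of f g "-1"]
  by (simp add: minus_ereal_def one_ereal_def[symmetric] flip: uminus_ereal.simps(1))

lemma abs_closed: "f \<in> E \<Longrightarrow> (\<lambda>t. \<bar>f t\<bar>) \<in> E"
  and norm_abs: "f \<in> E \<Longrightarrow> N (\<lambda>t. \<bar>f t\<bar>) = N f"
proof -
  assume f: "f \<in> E"
  have a: "(\<lambda>t. \<bar>f t\<bar>) \<in> E \<and> N (\<lambda>t. \<bar>f t\<bar>) \<le> N f"
    using f by (intro ideal) (auto simp: L0_def)
  then show "(\<lambda>t. \<bar>f t\<bar>) \<in> E" by simp
  have "N f \<le> N (\<lambda>t. \<bar>f t\<bar>)"
    using ideal[of f "\<lambda>t. \<bar>f t\<bar>"] a E_L0[OF f] by auto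
  then show "N (\<lambda>t. \<bar>f t\<bar>) = N f"
    using a by simp
qed

text \<open>The ideal property combined with the triangle inequality; it reduces norm estimates to
  pointwise inequalities that hold almost everywhere.\<close>

lemma norm_le_add:
  assumes "h \<in> borel_measurable (leb_I \<alpha>)" "f \<in> E" "g \<in> E" "AE t in leb_I \<alpha>. \<bar>h t\<bar> \<le> \<bar>f t\<bar> + \<bar>g t\<bar>"
  shows "h \<in> E" "N h \<le> N f + N g"
proof -
  have "\<bar>\<bar>f t\<bar> + \<bar>g t\<bar>\<bar> = \<bar>f t\<bar> + \<bar>g t\<bar>" for t
    by (simp add: abs_ereal_ge0)
  then have "h \<in> E \<and> N h \<le> N (\<lambda>t. \<bar>f t\<bar> + \<bar>g t\<bar>)"
    using assms by (intro ideal add_closed abs_closed) (simp_all add: L0_def)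
  moreover have "N (\<lambda>t. \<bar>f t\<bar> + \<bar>g t\<bar>) \<le> N f + N g"
    using norm_triangle[OF abs_closed abs_closed, of f g] assms by (simp add: norm_abs)
  ultimately show "h \<in> E" "N h \<le> N f + N g" by auto
qed

text \<open>Indicators of sets of equal measure are equimeasurable.\<close>

lemma norm_indicator_emeasure_eq:
  assumes "indicator D \<in> E" "D \<in> sets (leb_I \<alpha>)" "C \<in> sets (leb_I \<alpha>)"
    and "emeasure (leb_I \<alpha>) C = emeasure (leb_I \<alpha>) D"
  shows "indicator C \<in> E" "N (indicator C) = N (indicator D)"
proof -
  have "distr_fun \<alpha> (indicator C) = distr_fun \<alpha> (indicator D)"
    using assms sets.sets_into_space[OF assms(2)] sets.sets_into_space[OF assms(3)]
    by (auto simp: fun_eq_iff distr_fun_indicator)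
  then show "indicator C \<in> E" "N (indicator C) = N (indicator D)"
    using symmetric[of "indicator C" "indicator D"] assms(1,3) by (auto simp: L0_def)
qed

section \<open>Comparison of truncations and level sets through rearrangements\<close>

lemma decr_rearr_closed: "x \<in> E \<Longrightarrow> decr_rearr \<alpha> x \<in> E"
  using symmetric[OF decr_rearr_L0 _ distr_fun_decr_rearr[OF _ alpha_nonneg]] E_L0 by blast

lemma norm_min_decr_rearr:
  assumes "u \<in> E" "0 \<le> \<eta>"
  shows "(\<lambda>t. min \<bar>u t\<bar> (ereal \<eta>)) \<in> E"
    "N (\<lambda>t. min \<bar>decr_rearr \<alpha> u t\<bar> (ereal \<eta>)) = N (\<lambda>t. min \<bar>u t\<bar> (ereal \<eta>))"
proof -
  show m: "(\<lambda>t. min \<bar>u t\<bar> (ereal \<eta>)) \<in> E"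
    using assms by (intro ideal[THEN conjunct1, of "\<lambda>t. min \<bar>u t\<bar> (ereal \<eta>)" u] AE_I2)
      (auto simp: L0_def abs_ereal_ge0)
  have "decr_rearr \<alpha> u \<in> E"
    using assms by (intro decr_rearr_closed)
  then show "N (\<lambda>t. min \<bar>decr_rearr \<alpha> u t\<bar> (ereal \<eta>)) = N (\<lambda>t. min \<bar>u t\<bar> (ereal \<eta>))"
    using symmetric[OF _ m, of "\<lambda>t. min \<bar>decr_rearr \<alpha> u t\<bar> (ereal \<eta>)"] assms
    by (auto simp: fun_eq_iff distr_fun_min distr_fun_decr_rearr alpha_nonneg E_L0 L0_def)
qed

lemma norm_excess_decr_rearr:
  assumes "u \<in> E" "0 \<le> K"
  shows "(\<lambda>t. max (\<bar>u t\<bar> - ereal K) 0) \<in> E"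
    "N (\<lambda>t. max (\<bar>decr_rearr \<alpha> u t\<bar> - ereal K) 0) = N (\<lambda>t. max (\<bar>u t\<bar> - ereal K) 0)"
proof -
  have "\<bar>max (\<bar>u t\<bar> - ereal K) 0\<bar> \<le> \<bar>u t\<bar>" for t
    using assms(2) by (cases "u t") (auto simp: max_def zero_ereal_def)
  then show m: "(\<lambda>t. max (\<bar>u t\<bar> - ereal K) 0) \<in> E"
    using ideal[of "\<lambda>t. max (\<bar>u t\<bar> - ereal K) 0" u] assms by (auto simp: L0_def)
  have "decr_rearr \<alpha> u \<in> E"
    using assms by (intro decr_rearr_closed)
  then show "N (\<lambda>t. max (\<bar>decr_rearr \<alpha> u t\<bar> - ereal K) 0) = N (\<lambda>t. max (\<bar>u t\<bar> - ereal K) 0)"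
    using symmetric[OF _ m, of "\<lambda>t. max (\<bar>decr_rearr \<alpha> u t\<bar> - ereal K) 0"] assms
    by (auto simp: fun_eq_iff distr_fun_excess distr_fun_decr_rearr alpha_nonneg E_L0 L0_def)
qed

lemma rearr_dist_closed: "x \<in> E \<Longrightarrow> u \<in> E \<Longrightarrow> (\<lambda>t. decr_rearr \<alpha> x t - decr_rearr \<alpha> u t) \<in> E"
  by (intro diff_closed decr_rearr_closed)

text \<open>Truncation at \<open>\<eta>\<close> is 1-Lipschitz, so the truncated rearrangements
  differ by no more than the rearrangements do. Symmetry carries the estimate back to
  \<open>x\<close> and \<open>u\<close>, whose own pointwise difference does not enter.\<close>

lemma norm_min_le:
  assumes "x \<in> E" "u \<in> E" "0 \<le> \<eta>"
  shows "N (\<lambda>t. min \<bar>u t\<bar> (ereal \<eta>))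
    \<le> N (\<lambda>t. decr_rearr \<alpha> x t - decr_rearr \<alpha> u t) + N (\<lambda>t. min \<bar>x t\<bar> (ereal \<eta>))"
proof -
  note E = decr_rearr_closed[OF assms(1)] decr_rearr_closed[OF assms(2)]
  have "N (\<lambda>t. min \<bar>decr_rearr \<alpha> u t\<bar> (ereal \<eta>))
    \<le> N (\<lambda>t. decr_rearr \<alpha> x t - decr_rearr \<alpha> u t) + N (\<lambda>t. min \<bar>decr_rearr \<alpha> x t\<bar> (ereal \<eta>))"
  proof (rule norm_le_add(2)[OF _ rearr_dist_closed norm_min_decr_rearr(1)])
    show "AE t in leb_I \<alpha>. \<bar>min \<bar>decr_rearr \<alpha> u t\<bar> (ereal \<eta>)\<bar>
        \<le> \<bar>decr_rearr \<alpha> x t - decr_rearr \<alpha> u t\<bar> + \<bar>min \<bar>decr_rearr \<alpha> x t\<bar> (ereal \<eta>)\<bar>"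
      using AE_finite[OF E(1)] AE_finite[OF E(2)]
    proof eventually_elim
      case (elim t)
      then show ?case
        using assms(3) by (cases "decr_rearr \<alpha> x t"; cases "decr_rearr \<alpha> u t") (auto simp: min_def)
    qed
  qed (use assms E in measurable)
  then show ?thesis
    using assms by (simp add: norm_min_decr_rearr)
qed

text \<open>The argument of \<open>norm_min_le\<close>, now for the positive part of
  \<open>p - K\<close>, which is 1-Lipschitz in \<open>p\<close> as well.\<close>

lemma norm_excess_le:
  assumes "x \<in> E" "u \<in> E" "0 \<le> K"
  shows "N (\<lambda>t. max (\<bar>u t\<bar> - ereal K) 0)
    \<le> N (\<lambda>t. decr_rearr \<alpha> x t - decr_rearr \<alpha> u t) + N (\<lambda>t. max (\<bar>x t\<bar> - ereal K) 0)"
proof -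
  note E = decr_rearr_closed[OF assms(1)] decr_rearr_closed[OF assms(2)]
  have "N (\<lambda>t. max (\<bar>decr_rearr \<alpha> u t\<bar> - ereal K) 0)
    \<le> N (\<lambda>t. decr_rearr \<alpha> x t - decr_rearr \<alpha> u t) + N (\<lambda>t. max (\<bar>decr_rearr \<alpha> x t\<bar> - ereal K) 0)"
  proof (rule norm_le_add(2)[OF _ rearr_dist_closed norm_excess_decr_rearr(1)])
    show "AE t in leb_I \<alpha>. \<bar>max (\<bar>decr_rearr \<alpha> u t\<bar> - ereal K) 0\<bar>
        \<le> \<bar>decr_rearr \<alpha> x t - decr_rearr \<alpha> u t\<bar> + \<bar>max (\<bar>decr_rearr \<alpha> x t\<bar> - ereal K) 0\<bar>"
      using AE_finite[OF E(1)] AE_finite[OF E(2)]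
    proof eventually_elim
      case (elim t)
      then show ?case
        using assms(3) by (cases "decr_rearr \<alpha> x t"; cases "decr_rearr \<alpha> u t")
          (auto simp: max_def zero_ereal_def)
    qed
  qed (use assms E in measurable)
  then show ?thesis
    using assms by (simp add: norm_excess_decr_rearr)
qed

text \<open>As in Chebyshev's inequality, the indicator is pointwise at most
  \<open>\<bar>x\<bar> / a\<close>.\<close>

lemma indicator_level_closed:
  assumes "x \<in> E" "0 < a" "D \<in> sets (leb_I \<alpha>)" "\<And>s. s \<in> D \<Longrightarrow> ereal a \<le> \<bar>x s\<bar>"
  shows "indicator D \<in> E"
proof -
  have "\<bar>indicator D t\<bar> \<le> \<bar>ereal (1 / a) * x t\<bar>" for t
    using assms(2) assms(4)[of t]
    by (cases "t \<in> D"; cases "x t") (auto simp: one_ereal_def field_simps abs_mult)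
  then show ?thesis
    using ideal[of "indicator D" "\<lambda>t. ereal (1 / a) * x t"] scale_closed[OF assms(1)] assms(3)
    by (auto simp: L0_def)
qed

lemma norm_indicator_le:
  assumes "f \<in> E" "g \<in> E" "D \<in> sets (leb_I \<alpha>)" "AE t in leb_I \<alpha>. t \<in> D \<longrightarrow> 1 \<le> \<bar>f t\<bar> + \<bar>g t\<bar>"
  shows "indicator D \<in> E" "N (indicator D) \<le> N f + N g"
proof -
  have "AE t in leb_I \<alpha>. \<bar>indicator D t\<bar> \<le> \<bar>f t\<bar> + \<bar>g t\<bar>"
    using assms(4) by eventually_elim (auto simp: indicator_def)
  from norm_le_add[OF _ assms(1,2) this] show "indicator D \<in> E" "N (indicator D) \<le> N f + N g"
    using assms(3) by auto
qed

text \<open>Where \<open>x\<^sup>* \<le> a < u\<^sup>*\<close>, either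
  \<open>x\<^sup>* \<le> a - e\<close>, and the rearrangements differ by more than \<open>e\<close>,
  or \<open>x\<^sup>*\<close> lies in the strip between \<open>a - e\<close> and \<open>a\<close>.
  Equality of measures moves the separation set from \<open>x\<close> and \<open>u\<close> to the
  rearrangements, and the strip back to \<open>x\<close>.\<close>

lemma norm_level_separation_le:
  assumes "x \<in> E" "u \<in> E" "AE t in leb_I \<alpha>. \<bar>x t\<bar> \<le> \<bar>u t\<bar>"
    and "0 < e" "e < a" "\<And>l. 0 < l \<Longrightarrow> distr_fun \<alpha> x l \<noteq> \<infinity>"
  shows "N (indicator {s \<in> space (leb_I \<alpha>). \<bar>x s\<bar> \<le> ereal a \<and> ereal a < \<bar>u s\<bar>})
    \<le> (1 / e) * N (\<lambda>t. decr_rearr \<alpha> x t - decr_rearr \<alpha> u t)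
      + N (indicator {s \<in> space (leb_I \<alpha>). ereal (a - e) < \<bar>x s\<bar> \<and> \<bar>x s\<bar> \<le> ereal a})"
proof -
  define g where "g = (\<lambda>t. decr_rearr \<alpha> x t - decr_rearr \<alpha> u t)"
  define D where "D f h = {s \<in> space (leb_I \<alpha>). \<bar>f s\<bar> \<le> ereal a \<and> ereal a < \<bar>h s\<bar>}"
    for f h :: "real \<Rightarrow> ereal"
  define S where "S f = {s \<in> space (leb_I \<alpha>). ereal (a - e) < \<bar>f s\<bar> \<and> \<bar>f s\<bar> \<le> ereal a}"
    for f :: "real \<Rightarrow> ereal"
  let ?x = "decr_rearr \<alpha> x" and ?u = "decr_rearr \<alpha> u"
  have E: "?x \<in> E" "?u \<in> E"
    using assms decr_rearr_closed by auto
  have gE: "g \<in> E"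
    unfolding g_def by (intro diff_closed E)
  have DS: "D f h \<in> sets (leb_I \<alpha>)" "S f \<in> sets (leb_I \<alpha>)" if "f \<in> E" "h \<in> E" for f h
    unfolding D_def S_def using that by measurable
  have distr: "distr_fun \<alpha> ?x = distr_fun \<alpha> x" "distr_fun \<alpha> ?u = distr_fun \<alpha> u"
    using assms E_L0 by (auto intro: distr_fun_decr_rearr alpha_nonneg)
  have xu: "\<bar>?x t\<bar> \<le> \<bar>?u t\<bar>" for t
    using decr_rearr_mono[OF distr_fun_mono[OF E_L0[OF assms(2)] assms(3)], of t]
    by (simp add: decr_rearr_nonneg abs_ereal_ge0)
  \<comment> \<open>Both measures are the difference of the same two distribution functions.\<close>
  have "emeasure (leb_I \<alpha>) (D x u) = emeasure (leb_I \<alpha>) (D ?x ?u)"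
    unfolding D_def using assms E xu
    by (subst (1 2) emeasure_level_separation) (auto simp: E_L0 distr)
  moreover have DE: "indicator (D f h) \<in> E" "indicator (S f) \<in> E" if "f \<in> E" "h \<in> E" for f h
  proof -
    show "indicator (D f h) \<in> E"
      by (rule indicator_level_closed[OF that(2), of a]) (use assms DS[OF that] in \<open>auto simp: D_def\<close>)
    show "indicator (S f) \<in> E"
      by (rule indicator_level_closed[OF that(1), of "a - e"]) (use assms DS[OF that] in \<open>auto simp: S_def\<close>)
  qed
  ultimately have "N (indicator (D x u)) = N (indicator (D ?x ?u))"
    using norm_indicator_emeasure_eq(2) DS E assms(1,2) by metis
  also have "\<dots> \<le> N (\<lambda>t. ereal (1 / e) * g t) + N (indicator (S ?x))"
  proof (rule norm_indicator_le(2)[OF scale_closed[OF gE] DE(2)[OF E] DS(1)[OF E]])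
    show "AE t in leb_I \<alpha>. t \<in> D ?x ?u \<longrightarrow> 1 \<le> \<bar>ereal (1 / e) * g t\<bar> + \<bar>indicator (S ?x) t\<bar>"
      using AE_finite[OF E(1)] AE_finite[OF E(2)]
    proof eventually_elim
      case (elim t)
      obtain p q where pq: "?x t = ereal p" "?u t = ereal q"
        using elim by (cases "?x t"; cases "?u t") auto
      have nn: "0 \<le> p" "0 \<le> q"
        using decr_rearr_nonneg[of \<alpha> x t] decr_rearr_nonneg[of \<alpha> u t] pq by auto
      show ?case
      proof (cases "p \<le> a - e")
        case True
        then have "1 \<le> \<bar>p - q\<bar> / e" if "a < q"
          using that assms(4) by (simp add: field_simps)
        then have "t \<in> D ?x ?u \<longrightarrow> 1 \<le> \<bar>ereal (1 / e) * g t\<bar>"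
          using nn assms(4) by (auto simp: D_def g_def pq one_ereal_def abs_mult)
        then show ?thesis
          using add_increasing2[of "\<bar>indicator (S ?x) t\<bar>" 1 "\<bar>ereal (1 / e) * g t\<bar>"] by auto
      next
        case False
        then show ?thesis
          using nn by (auto simp: D_def S_def pq add_increasing)
      qed
    qed
  qed
  \<comment> \<open>The strip is a difference of two level sets, so its measure is the same for
    \<open>x\<close> and \<open>x\<^sup>*\<close>; the subtraction requires
    \<open>distr_fun \<alpha> x a\<close> to be finite.\<close>
  also have "N (indicator (S ?x)) = N (indicator (S x))"
  proof (rule norm_indicator_emeasure_eq(2)[OF DE(2)[OF assms(1,1)] DS(2)[OF assms(1,1)] DS(2)[OF E]])
    have S: "S f = {s \<in> space (leb_I \<alpha>). ereal (a - e) < \<bar>f s\<bar>} - {s \<in> space (leb_I \<alpha>). ereal a < \<bar>f s\<bar>}"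
      for f
      by (auto simp: S_def)
    have "emeasure (leb_I \<alpha>) (S f) = distr_fun \<alpha> f (a - e) - distr_fun \<alpha> f a"
      if "f \<in> E" "distr_fun \<alpha> f a \<noteq> \<infinity>" for f
      unfolding S distr_fun_def
    proof (rule emeasure_Diff)
      show "{s \<in> space (leb_I \<alpha>). ereal a < \<bar>f s\<bar>} \<subseteq> {s \<in> space (leb_I \<alpha>). ereal (a - e) < \<bar>f s\<bar>}"
        using assms(4) less_trans[of "ereal (a - e)" "ereal a"] by auto
    qed (use that sets_gt_abs[OF E_L0[OF that(1)]] in \<open>auto simp: distr_fun_def\<close>)
    then show "emeasure (leb_I \<alpha>) (S ?x) = emeasure (leb_I \<alpha>) (S x)"
      using assms E by (simp add: distr)
  qed
  finally show ?thesis
    using assms(4) norm_scale[OF gE, of "1 / e"] by (simp add: D_def S_def g_def)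
qed

section \<open>Consequences of order continuity\<close>

lemma oc_pointD:
  assumes "oc_point \<alpha> E N x" "\<And>n. T n \<in> borel_measurable (leb_I \<alpha>)"
    and "\<And>n. AE t in leb_I \<alpha>. 0 \<le> T n t \<and> T n t \<le> \<bar>x t\<bar>"
    and "AE t in leb_I \<alpha>. (\<lambda>n. T n t) \<longlonglongrightarrow> 0"
  shows "(\<lambda>n::nat. N (T n)) \<longlonglongrightarrow> 0"
proof -
  have x: "x \<in> E"
    using assms(1) by (simp add: oc_point_def)
  have "T n \<in> E" for n
  proof (rule ideal[THEN conjunct1, OF _ x])
    show "AE t in leb_I \<alpha>. \<bar>T n t\<bar> \<le> \<bar>x t\<bar>"
      using assms(3)[of n] by eventually_elim (simp add: abs_ereal_ge0)
  qed (use assms(2) in \<open>simp add: L0_def\<close>)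
  moreover have "AE t in leb_I \<alpha>. 0 \<le> T n t" "AE t in leb_I \<alpha>. T n t \<le> \<bar>x t\<bar>" for n
    using assms(3)[of n] by (auto elim: eventually_mono)
  ultimately show ?thesis
    using assms(1,4) by (simp add: oc_point_def pos_cone_def)
qed

lemma oc_min_tendsto:
  assumes "oc_point \<alpha> E N x"
  shows "(\<lambda>n. N (\<lambda>t. min \<bar>x t\<bar> (ereal (1 / Suc n)))) \<longlonglongrightarrow> 0"
proof (rule oc_pointD[OF assms])
  have [measurable]: "x \<in> borel_measurable (leb_I \<alpha>)"
    using assms by (intro E_measurable) (simp add: oc_point_def)
  show "(\<lambda>t. min \<bar>x t\<bar> (ereal (1 / Suc n))) \<in> borel_measurable (leb_I \<alpha>)" for n
    by measurable
  have lim: "(\<lambda>n. ereal (1 / Suc n)) \<longlonglongrightarrow> 0"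
    using LIMSEQ_inverse_real_of_nat unfolding zero_ereal_def by (simp add: inverse_eq_divide)
  have "(\<lambda>n. min \<bar>x t\<bar> (ereal (1 / Suc n))) \<longlonglongrightarrow> 0" for t
    by (rule tendsto_sandwich[OF _ _ tendsto_const lim]) auto
  then show "AE t in leb_I \<alpha>. (\<lambda>n. min \<bar>x t\<bar> (ereal (1 / Suc n))) \<longlonglongrightarrow> 0"
    by simp
qed auto

text \<open>Elements of \<open>E\<close> are finite almost everywhere, so at almost every point the
  excess over \<open>n\<close> eventually vanishes.\<close>

lemma oc_excess_tendsto:
  assumes "oc_point \<alpha> E N x"
  shows "(\<lambda>n. N (\<lambda>t. max (\<bar>x t\<bar> - ereal (real n)) 0)) \<longlonglongrightarrow> 0"
proof (rule oc_pointD[OF assms])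
  have x: "x \<in> E"
    using assms by (simp add: oc_point_def)
  then show "(\<lambda>t. max (\<bar>x t\<bar> - ereal (real n)) 0) \<in> borel_measurable (leb_I \<alpha>)" for n
    by measurable
  have "max (\<bar>x t\<bar> - ereal (real n)) 0 \<le> \<bar>x t\<bar>" for n t
    by (cases "x t") (auto simp: max_def zero_ereal_def)
  then show "AE t in leb_I \<alpha>. 0 \<le> max (\<bar>x t\<bar> - ereal (real n)) 0 \<and> max (\<bar>x t\<bar> - ereal (real n)) 0 \<le> \<bar>x t\<bar>"
    for n by simp
  show "AE t in leb_I \<alpha>. (\<lambda>n. max (\<bar>x t\<bar> - ereal (real n)) 0) \<longlonglongrightarrow> 0"
    using AE_finite[OF x]
  proof eventually_elim
    case (elim t)
    then obtain r where r: "x t = ereal r" by (cases "x t") auto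
    have "eventually (\<lambda>n. \<bar>r\<bar> \<le> real n) sequentially"
      using filterlim_real_sequentially by (simp add: filterlim_at_top)
    then have "eventually (\<lambda>n. max (\<bar>x t\<bar> - ereal (real n)) 0 = 0) sequentially"
      by eventually_elim (simp add: r max_def zero_ereal_def)
    then show ?case
      by (rule tendsto_eventually)
  qed
qed

text \<open>The strips are open at the upper end and hence shrink to the empty set; strips closed at
  \<open>a\<close> would all contain the set where \<open>\<bar>x\<bar> = a\<close>.\<close>

lemma oc_level_strip_tendsto:
  assumes "oc_point \<alpha> E N x" "0 < a"
  shows "(\<lambda>n. N (indicator {s \<in> space (leb_I \<alpha>). ereal (a - a / (n + 2)) < \<bar>x s\<bar> \<and> \<bar>x s\<bar> < ereal a}))
    \<longlonglongrightarrow> 0"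
proof -
  define S where "S n = {s \<in> space (leb_I \<alpha>). ereal (a - a / (real n + 2)) < \<bar>x s\<bar> \<and> \<bar>x s\<bar> < ereal a}" for n
  \<comment> \<open>The offset 2 in \<open>S n\<close> keeps \<open>\<bar>x\<bar>\<close> above
    \<open>a / 2\<close> on every strip, so with this factor the indicators are dominated by
    \<open>\<bar>x\<bar>\<close>.\<close>
  define T where "T n = (\<lambda>t. ereal (a / 2) * indicator (S n) t)" for n
  have x: "x \<in> E"
    using assms by (simp add: oc_point_def)
  then have S: "S n \<in> sets (leb_I \<alpha>)" for n
    unfolding S_def by measurable
  have half: "a / 2 \<le> a - a / (real n + 2)" for n
    using assms(2) by (simp add: field_simps)
  have low: "ereal (a / 2) \<le> \<bar>x s\<bar>" if "s \<in> S n" for n s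
    using that half[of n] by (cases "x s") (auto simp: S_def)
  have "(\<lambda>n. N (T n)) \<longlonglongrightarrow> 0"
  proof (rule oc_pointD[OF assms(1)])
    show "T n \<in> borel_measurable (leb_I \<alpha>)" for n
      unfolding T_def using S by measurable
    show "AE t in leb_I \<alpha>. 0 \<le> T n t \<and> T n t \<le> \<bar>x t\<bar>" for n
      using low[of _ n] assms(2) by (auto simp: T_def indicator_def)
    have "eventually (\<lambda>n. T n t = 0) sequentially" for t
    proof (cases "\<bar>x t\<bar> < ereal a")
      case True
      then obtain r where r: "\<bar>x t\<bar> = ereal r" "r < a" by (cases "x t") auto
      have "(\<lambda>n. a - a / (real n + 2)) \<longlonglongrightarrow> a - 0"
        using LIMSEQ_ignore_initial_segment[OF lim_const_over_n[of a], of 2]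
        by (intro tendsto_diff tendsto_const) (simp add: add.commute)
      then have "eventually (\<lambda>n. r < a - a / (real n + 2)) sequentially"
        using r(2) by (intro order_tendstoD) auto
      then show ?thesis
        by eventually_elim (auto simp: T_def S_def r indicator_def)
    qed (simp add: T_def S_def)
    then show "AE t in leb_I \<alpha>. (\<lambda>n. T n t) \<longlonglongrightarrow> 0"
      by (auto intro!: tendsto_eventually)
  qed
  then have "(\<lambda>n. (2 / a) * N (T n)) \<longlonglongrightarrow> 0"
    using tendsto_mult_right_zero by blast
  moreover have "(2 / a) * N (T n) = N (indicator (S n))" for n
  proof -
    have "indicator (S n) \<in> E"
      using indicator_level_closed[OF x _ S low] assms(2) by simp
    then show ?thesis
      using norm_scale[of "indicator (S n)" "a / 2"] assms(2) by (simp add: T_def field_simps)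
  qed
  ultimately show ?thesis
    by (simp add: S_def add.commute)
qed

text \<open>If a level set had infinite measure, so would all of its tails; these would be equimeasurable,
  while order continuity sends the norms of their indicators to \<open>0\<close>.\<close>

lemma oc_distr_fun_finite:
  assumes "oc_point \<alpha> E N x" "0 < l"
  shows "distr_fun \<alpha> x l \<noteq> \<infinity>"
proof
  assume inf: "distr_fun \<alpha> x l = \<infinity>"
  define A where "A n = {s \<in> space (leb_I \<alpha>). ereal l < \<bar>x s\<bar>} \<inter> ({real n..} \<inter> space (leb_I \<alpha>))"
    for n
  have x: "x \<in> E"
    using assms by (simp add: oc_point_def)
  have A: "A n \<in> sets (leb_I \<alpha>)" for n
    unfolding A_def by (intro sets.Int sets_gt_abs E_L0 x sets_leb_I_interval) (auto simp: is_interval_1)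
  have level: "ereal l \<le> \<bar>x s\<bar>" if "s \<in> A n" for n s
    using that by (auto simp: A_def)
  have AE: "indicator (A n) \<in> E" for n
    by (rule indicator_level_closed[OF x assms(2) A level])
  \<comment> \<open>What \<open>A n\<close> lacks of the full level set lies in a bounded interval,
    which has finite measure.\<close>
  have measure: "emeasure (leb_I \<alpha>) (A n) = \<infinity>" for n
  proof (rule ccontr)
    assume fin: "emeasure (leb_I \<alpha>) (A n) \<noteq> \<infinity>"
    have B: "{t \<in> space (leb_I \<alpha>). t < real n} \<in> sets (leb_I \<alpha>)"
      using sets_leb_I_interval[of "{..<real n}" \<alpha>]
      by (auto simp: is_interval_1 Int_def conj_commute)
    have "distr_fun \<alpha> x l \<le> emeasure (leb_I \<alpha>) (A n \<union> {t \<in> space (leb_I \<alpha>). t < real n})"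
      unfolding distr_fun_def by (rule emeasure_mono) (use A B in \<open>auto simp: A_def\<close>)
    also have "\<dots> \<le> emeasure (leb_I \<alpha>) (A n) + emeasure (leb_I \<alpha>) {t \<in> space (leb_I \<alpha>). t < real n}"
      by (rule emeasure_subadditive) (use A B in auto)
    finally have "distr_fun \<alpha> x l
        \<le> emeasure (leb_I \<alpha>) (A n) + emeasure (leb_I \<alpha>) {t \<in> space (leb_I \<alpha>). t < real n}" .
    then show False
      using inf fin emeasure_leb_I_bounded[of \<alpha> "real n"] by (simp add: top_unique)
  qed
  have "(\<lambda>n. N (\<lambda>t. ereal l * indicator (A n) t)) \<longlonglongrightarrow> 0"
  proof (rule oc_pointD[OF assms(1)])
    show "(\<lambda>t. ereal l * indicator (A n) t) \<in> borel_measurable (leb_I \<alpha>)" for n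
      using A by measurable
    show "AE t in leb_I \<alpha>. 0 \<le> ereal l * indicator (A n) t \<and> ereal l * indicator (A n) t \<le> \<bar>x t\<bar>" for n
      using level[of _ n] assms(2) by (auto simp: indicator_def)
    have "eventually (\<lambda>n. ereal l * indicator (A n) t = 0) sequentially" for t
    proof -
      have "eventually (\<lambda>n. t < real n) sequentially"
        using filterlim_real_sequentially by (simp add: filterlim_at_top_dense)
      then show ?thesis
        by eventually_elim (simp add: A_def)
    qed
    then show "AE t in leb_I \<alpha>. (\<lambda>n. ereal l * indicator (A n) t) \<longlonglongrightarrow> 0"
      by (auto intro!: tendsto_eventually)
  qed
  moreover have "N (\<lambda>t. ereal l * indicator (A n) t) = l * N (indicator (A 0))" for n
    using norm_scale[OF AE, of l n] assms(2)
      norm_indicator_emeasure_eq(2)[OF AE[of 0] A A, of n] by (simp add: measure)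
  ultimately have "l * N (indicator (A 0)) = 0"
    using LIMSEQ_unique tendsto_const by fastforce
  then have "AE t in leb_I \<alpha>. indicator (A 0) t = (0 :: ereal)"
    using assms(2) norm_zero_iff[OF AE] by simp
  then have "AE t in leb_I \<alpha>. t \<notin> A 0"
    by eventually_elim (auto simp: indicator_def split: if_splits)
  then have "emeasure (leb_I \<alpha>) (A 0) = 0"
    using A AE_iff_null_sets[of "A 0"] by (auto simp: null_sets_def)
  then show False
    using measure[of 0] by simp
qed

text \<open>Order continuity asks for convergence almost everywhere. If the norms stayed away from
  \<open>0\<close> along a subsequence, Borel-Cantelli would select indices along which
  \<open>Z\<close>, and therefore \<open>Y\<close>, tends to \<open>0\<close> almost
  everywhere.\<close>

lemma oc_dominated_in_measure:
  assumes "oc_point \<alpha> E N x"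
    and Y [measurable]: "\<And>n. Y n \<in> borel_measurable (leb_I \<alpha>)"
    and Z [measurable]: "\<And>n. Z n \<in> borel_measurable (leb_I \<alpha>)"
    and bounds: "\<And>n. AE t in leb_I \<alpha>. 0 \<le> Y n t \<and> Y n t \<le> \<bar>x t\<bar> \<and> Y n t \<le> \<bar>Z n t\<bar>"
    and measure: "\<And>e. 0 < e \<Longrightarrow>
      (\<lambda>n::nat. emeasure (leb_I \<alpha>) {t \<in> space (leb_I \<alpha>). ereal e < \<bar>Z n t\<bar>}) \<longlonglongrightarrow> 0"
  shows "(\<lambda>n. N (Y n)) \<longlonglongrightarrow> 0"
proof (rule ccontr)
  assume "\<not> (\<lambda>n. N (Y n)) \<longlonglongrightarrow> 0"
  then obtain e where e: "0 < e" "\<And>m. \<exists>n\<ge>m. e \<le> \<bar>N (Y n)\<bar>"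
    by (auto simp: LIMSEQ_iff not_less)
  \<comment> \<open>The number \<open>(1/2)^k\<close> serves twice: as a threshold tending to
    \<open>0\<close>, and as a summable bound for the measure of \<open>A k (r k)\<close>.\<close>
  define A where "A k n = {t \<in> space (leb_I \<alpha>). ereal ((1/2)^k) < \<bar>Z n t\<bar>}" for k n
  have [measurable]: "A k n \<in> sets (leb_I \<alpha>)" for k n
    unfolding A_def by measurable
  have "\<exists>n. e \<le> \<bar>N (Y n)\<bar> \<and> emeasure (leb_I \<alpha>) (A k n) < ennreal ((1/2)^k)" for k
  proof -
    have "eventually (\<lambda>n. emeasure (leb_I \<alpha>) (A k n) < ennreal ((1/2)^k)) sequentially"
      unfolding A_def by (rule order_tendstoD[OF measure]) auto
    then show ?thesis
      using e(2) by (auto simp: eventually_sequentially)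
  qed
  \<comment> \<open>The indices \<open>r k\<close> need not increase, since both bounds are stated
    in terms of \<open>k\<close>.\<close>
  then obtain r where r: "\<And>k. e \<le> \<bar>N (Y (r k))\<bar>"
      "\<And>k. emeasure (leb_I \<alpha>) (A k (r k)) < ennreal ((1/2)^k)"
    by metis
  have fin: "emeasure (leb_I \<alpha>) (A k (r k)) < \<infinity>" for k
    using less_trans[OF r(2) ennreal_less_top] by simp
  have le: "Sigma_Algebra.measure (leb_I \<alpha>) (A k (r k)) \<le> (1/2)^k" for k
    unfolding Sigma_Algebra.measure_def using less_imp_le[OF r(2)[of k]] by (intro enn2real_leI) auto
  have "summable (\<lambda>k. Sigma_Algebra.measure (leb_I \<alpha>) (A k (r k)))"
    by (rule summable_comparison_test[OF _ summable_geometric[of "1/2 :: real"]])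
      (use le in auto)
  from borel_cantelli_AE1[OF _ fin this]
  have "AE t in leb_I \<alpha>. eventually (\<lambda>k. t \<in> space (leb_I \<alpha>) - A k (r k)) sequentially"
    by simp
  moreover have "AE t in leb_I \<alpha>. \<forall>k. 0 \<le> Y (r k) t \<and> Y (r k) t \<le> \<bar>Z (r k) t\<bar>"
    unfolding AE_all_countable using bounds by (auto elim: eventually_mono)
  ultimately have lim: "AE t in leb_I \<alpha>. (\<lambda>k. Y (r k) t) \<longlonglongrightarrow> 0"
  proof eventually_elim
    case (elim t)
    have "eventually (\<lambda>k. Y (r k) t \<le> ereal ((1/2)^k)) sequentially"
      using elim(1)
    proof eventually_elim
      case (elim k)
      then have "\<bar>Z (r k) t\<bar> \<le> ereal ((1/2)^k)"
        by (auto simp: A_def)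
      with \<open>\<forall>k. 0 \<le> Y (r k) t \<and> Y (r k) t \<le> \<bar>Z (r k) t\<bar>\<close> show ?case
        using order_trans by blast
    qed
    moreover have "(\<lambda>k. ereal ((1/2)^k)) \<longlonglongrightarrow> 0"
      unfolding zero_ereal_def by (intro tendsto_intros LIMSEQ_power_zero) auto
    ultimately show ?case
      using elim(2) by (intro tendsto_sandwich[of "\<lambda>_. 0" "\<lambda>k. Y (r k) t" _ "\<lambda>k. ereal ((1/2)^k)"]) auto
  qed
  have "(\<lambda>k. N (Y (r k))) \<longlonglongrightarrow> 0"
    by (rule oc_pointD[OF assms(1) Y _ lim]) (use bounds in \<open>auto elim: eventually_mono\<close>)
  then have "eventually (\<lambda>k. \<bar>N (Y (r k))\<bar> < e) sequentially"
    using e(1) by (auto simp: tendsto_iff dist_real_def)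
  then show False
    using r(1) by (auto simp: eventually_sequentially not_less[symmetric])
qed

end

section \<open>Elementary estimates for numbers\<close>

lemma ereal_abs_le_abs: "\<bar>a\<bar> \<le> b \<Longrightarrow> \<bar>a\<bar> \<le> \<bar>b\<bar>" for a b :: ereal
  by (cases a; cases b) auto

lemma tendsto_0_nonnegI:
  fixes f :: "nat \<Rightarrow> real"
  assumes "\<And>n. 0 \<le> f n" "0 < C" "\<And>e. 0 < e \<Longrightarrow> eventually (\<lambda>n. f n < C * e) sequentially"
  shows "f \<longlonglongrightarrow> 0"
proof (rule tendstoI)
  fix e :: real assume "0 < e"
  then have "eventually (\<lambda>n. f n < C * (e / C)) sequentially"
    using assms(2) by (intro assms(3)) simp
  then show "eventually (\<lambda>n. dist (f n) 0 < e) sequentially"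
    using assms(1,2) by simp
qed

text \<open>If \<open>q < \<eta>\<close>, the first term suffices; if \<open>q \<ge> K\<close>, the
  second does, as \<open>2 * (q - K / 2) \<ge> q\<close>. In between, a grid point separating
  \<open>p\<close> from \<open>q\<close> costs at most \<open>K\<close>. Without one,
  \<open>p \<ge> \<eta>\<close> because \<open>\<eta>\<close> is itself a grid point, and
  \<open>q\<close> stays below the first grid point after \<open>p\<close>, so
  \<open>q - p \<le> \<delta> * \<eta> \<le> \<delta> * p\<close>.\<close>

lemma grid_estimate:
  fixes p q :: real
  assumes "0 \<le> p" "p \<le> q" "0 < \<eta>" "0 < \<delta>" "0 < K" "K \<le> \<eta> + real J * (\<delta> * \<eta>)"
  shows "q - p \<le> min q \<eta> + (2 * max (q - K / 2) 0 + (\<delta> * p +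
    K * of_bool (\<exists>a\<in>(\<lambda>j. \<eta> + real j * (\<delta> * \<eta>)) ` {..J}. p < a \<and> a \<le> q)))"
proof (cases "q < \<eta> \<or> K \<le> q")
  case True
  have "0 \<le> \<delta> * p" "0 \<le> K * of_bool (\<exists>a\<in>(\<lambda>j. \<eta> + real j * (\<delta> * \<eta>)) ` {..J}. p < a \<and> a \<le> q)"
    using assms by simp_all
  moreover have "q - p \<le> min q \<eta> + 2 * max (q - K / 2) 0"
    using True assms by (auto simp: min_def max_def)
  ultimately show ?thesis
    by linarith
next
  case False
  let ?P = "\<exists>a\<in>(\<lambda>j. \<eta> + real j * (\<delta> * \<eta>)) ` {..J}. p < a \<and> a \<le> q"
  have pos: "0 \<le> \<delta> * p" "0 < \<delta> * \<eta>" using assms by simp_all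
  show ?thesis
  proof (cases ?P)
    case True
    have "0 \<le> min q \<eta>" "0 \<le> 2 * max (q - K / 2) 0" using assms by auto
    moreover have "q - p \<le> K" using False assms by simp
    moreover have "K * of_bool ?P = K" using True by simp
    ultimately show ?thesis
      using pos(1) by linarith
  next
    case notP: False
    have "\<not> p < \<eta>"
    proof
      assume "p < \<eta>"
      then have ?P
        using False by (intro bexI[of _ "\<eta> + real 0 * (\<delta> * \<eta>)"] image_eqI[of _ _ 0]) auto
      then show False using notP by simp
    qed
    \<comment> \<open>The index of the first grid point strictly above \<open>p\<close>.\<close>
    define j where "j = nat \<lfloor>(p - \<eta>) / (\<delta> * \<eta>)\<rfloor> + 1"
    have "0 \<le> (p - \<eta>) / (\<delta> * \<eta>)"
      using pos \<open>\<not> p < \<eta>\<close> by simp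
    then have j: "real j = of_int \<lfloor>(p - \<eta>) / (\<delta> * \<eta>)\<rfloor> + 1"
      unfolding j_def by simp
    have "(p - \<eta>) / (\<delta> * \<eta>) < real j" "real j - 1 \<le> (p - \<eta>) / (\<delta> * \<eta>)"
      unfolding j by linarith+
    then have "p - \<eta> < real j * (\<delta> * \<eta>)" "(real j - 1) * (\<delta> * \<eta>) \<le> p - \<eta>"
      using pos(2) by (simp_all only: pos_divide_less_eq pos_le_divide_eq)
    then have j1: "p < \<eta> + real j * (\<delta> * \<eta>)" and j2: "\<eta> + real j * (\<delta> * \<eta>) \<le> p + \<delta> * \<eta>"
      by (simp_all add: algebra_simps)
    \<comment> \<open>Otherwise the last grid point, and with it \<open>K\<close>, would be at most
      \<open>p\<close>, although \<open>p \<le> q < K\<close>.\<close>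
    have jJ: "j \<le> J"
    proof (rule ccontr)
      assume "\<not> j \<le> J"
      then have "real J \<le> real j - 1" by linarith
      then have "real J * (\<delta> * \<eta>) \<le> (real j - 1) * (\<delta> * \<eta>)"
        using pos(2) by (intro mult_right_mono) auto
      then have "K \<le> p" using assms(6) j2 by (simp add: algebra_simps)
      then show False using False assms(2) by simp
    qed
    have "q < \<eta> + real j * (\<delta> * \<eta>)"
      using notP j1 jJ by (meson atMost_iff image_eqI not_less)
    also note j2
    also have "\<delta> * \<eta> \<le> \<delta> * p"
      using \<open>\<not> p < \<eta>\<close> assms by simp
    finally have "q - p \<le> \<delta> * p" by simp
    moreover have "0 \<le> min q \<eta>" "0 \<le> 2 * max (q - K / 2) 0" using assms by auto
    moreover have "K * of_bool ?P = 0" using notP by simp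
    ultimately show ?thesis
      by linarith
  qed
qed

section \<open>From convergence of rearrangements to the ULUM property\<close>

context symmetric_space
begin

lemma level_separation_tendsto:
  assumes "oc_point \<alpha> E N x" "\<And>n. X n \<in> E" "\<And>n. AE t in leb_I \<alpha>. \<bar>x t\<bar> \<le> \<bar>X n t\<bar>"
    and "(\<lambda>n::nat. N (\<lambda>t. decr_rearr \<alpha> x t - decr_rearr \<alpha> (X n) t)) \<longlonglongrightarrow> 0" "0 < a"
  shows "(\<lambda>n. N (indicator {s \<in> space (leb_I \<alpha>). \<bar>x s\<bar> < ereal a \<and> ereal a \<le> \<bar>X n s\<bar>})) \<longlonglongrightarrow> 0"
proof -
  \<comment> \<open>\<open>distr_fun\<close> controls only strict upper level sets, and \<open>distr_fun\<close> of \<open>X n\<close> may be infinite;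
    hence the detour through a level \<open>b\<close> slightly below \<open>a\<close>.\<close>
  define B where "B n = {s \<in> space (leb_I \<alpha>). \<bar>x s\<bar> < ereal a \<and> ereal a \<le> \<bar>X n s\<bar>}" for n
  define S where "S m = {s \<in> space (leb_I \<alpha>). ereal (a - a / (real m + 2)) < \<bar>x s\<bar> \<and> \<bar>x s\<bar> < ereal a}" for m
  have x: "x \<in> E"
    using assms by (simp add: oc_point_def)
  have B: "B n \<in> sets (leb_I \<alpha>)" for n
    unfolding B_def using x assms(2) by measurable
  have S: "S m \<in> sets (leb_I \<alpha>)" for m
    unfolding S_def using x by measurable
  have BE: "indicator (B n) \<in> E" for n
    by (rule indicator_level_closed[OF assms(2) assms(5) B]) (auto simp: B_def)
  \<comment> \<open>The factor 3 counts the strip \<open>S m\<close>, the strip \<open>C\<close> and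
    the rearrangement distance divided by \<open>e\<close>, each contributing at most
    \<open>\<epsilon>\<close>.\<close>
  have "(\<lambda>n. N (indicator (B n))) \<longlonglongrightarrow> 0"
  proof (rule tendsto_0_nonnegI[where C = 3])
    fix \<epsilon> :: real assume \<epsilon>: "0 < \<epsilon>"
    have "eventually (\<lambda>m. N (indicator (S m)) < \<epsilon>) sequentially"
      using order_tendstoD(2)[OF oc_level_strip_tendsto[OF assms(1,5)] \<epsilon>] by (simp add: S_def add.commute)
    then obtain m where m: "N (indicator (S m)) < \<epsilon>"
      by (auto simp: eventually_sequentially)
    define e where "e = a / (real m + 2) / 2"
    define b where "b = a - e"
    have "0 < e" "a - a / (real m + 2) = b - e"
      using assms(5) unfolding e_def b_def by (simp, linarith)
    moreover have "a / (real m + 2) \<le> a / 2"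
      using assms(5) by (intro divide_left_mono) auto
    from divide_right_mono[OF this, of 2] have "e \<le> a / 4"
      unfolding e_def by simp
    ultimately have e: "0 < e" "e < b" "b < a" "a - a / (real m + 2) = b - e"
      using assms(5) unfolding b_def by auto
    have SE: "indicator (S m) \<in> E"
      by (rule indicator_level_closed[OF x _ S, of "b - e"]) (use e in \<open>auto simp: S_def\<close>)
    define D where "D n = {s \<in> space (leb_I \<alpha>). \<bar>x s\<bar> \<le> ereal b \<and> ereal b < \<bar>X n s\<bar>}" for n
    define C where "C = {s \<in> space (leb_I \<alpha>). ereal (b - e) < \<bar>x s\<bar> \<and> \<bar>x s\<bar> \<le> ereal b}"
    have D: "D n \<in> sets (leb_I \<alpha>)" for n
      unfolding D_def using x assms(2) by measurable
    have C: "C \<in> sets (leb_I \<alpha>)"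
      unfolding C_def using x by measurable
    have DE: "indicator (D n) \<in> E" for n
      by (rule indicator_level_closed[OF assms(2)[of n] _ D, where a = b]) (use e in \<open>auto simp: D_def\<close>)
    have ba: "ereal b < ereal a" using e by simp
    have "C \<subseteq> S m"
      using le_less_trans[OF _ ba] unfolding C_def S_def e(4) by blast
    then have CS: "N (indicator C) \<le> N (indicator (S m))"
      using C by (intro ideal[THEN conjunct2, OF _ SE] AE_I2) (auto simp: L0_def indicator_def)
    have "eventually (\<lambda>n. N (\<lambda>t. decr_rearr \<alpha> x t - decr_rearr \<alpha> (X n) t) < e * \<epsilon>) sequentially"
      using order_tendstoD(2)[OF assms(4), of "e * \<epsilon>"] e(1) \<epsilon> by simp
    then show "eventually (\<lambda>n. N (indicator (B n)) < 3 * \<epsilon>) sequentially"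
    proof eventually_elim
      case (elim n)
      have "B n \<subseteq> D n \<union> S m"
      proof
        fix s assume s: "s \<in> B n"
        show "s \<in> D n \<union> S m"
        proof (cases "\<bar>x s\<bar> \<le> ereal b")
          case True
          then show ?thesis
            using s less_le_trans[OF ba] by (auto simp: B_def D_def)
        next
          case False
          have "ereal (b - e) < ereal b" using e(1) by simp
          also have "\<dots> < \<bar>x s\<bar>" using False by simp
          finally show ?thesis
            using s by (simp add: B_def S_def e(4))
        qed
      qed
      then have "N (indicator (B n)) \<le> N (indicator (D n)) + N (indicator (S m))"
        by (intro norm_indicator_le(2) DE SE B) (auto simp: indicator_def)
      also have "N (indicator (D n)) \<le> (1 / e) * N (\<lambda>t. decr_rearr \<alpha> x t - decr_rearr \<alpha> (X n) t)
          + N (indicator C)"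
        unfolding D_def C_def
        by (rule norm_level_separation_le[OF x assms(2,3) e(1,2) oc_distr_fun_finite[OF assms(1)]])
      also have "(1 / e) * N (\<lambda>t. decr_rearr \<alpha> x t - decr_rearr \<alpha> (X n) t) < \<epsilon>"
        using elim e(1) by (simp add: field_simps)
      finally show ?case
        using CS m by simp
    qed
  qed (auto intro: norm_nonneg BE)
  then show ?thesis
    by (simp add: B_def)
qed

text \<open>Induction on \<open>L\<close> with the triangle inequality. Membership in
  \<open>E\<close> is part of the claim because the norm estimate of the inductive step presupposes
  it.\<close>

lemma level_separation_finite_tendsto:
  assumes "oc_point \<alpha> E N x" "\<And>n. X n \<in> E" "\<And>n. AE t in leb_I \<alpha>. \<bar>x t\<bar> \<le> \<bar>X n t\<bar>"
    and "(\<lambda>n::nat. N (\<lambda>t. decr_rearr \<alpha> x t - decr_rearr \<alpha> (X n) t)) \<longlonglongrightarrow> 0"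
    and "finite L" "L \<subseteq> {0<..}"
  shows "(\<forall>n. indicator {s \<in> space (leb_I \<alpha>). \<exists>a\<in>L. \<bar>x s\<bar> < ereal a \<and> ereal a \<le> \<bar>X n s\<bar>} \<in> E) \<and>
    (\<lambda>n. N (indicator {s \<in> space (leb_I \<alpha>). \<exists>a\<in>L. \<bar>x s\<bar> < ereal a \<and> ereal a \<le> \<bar>X n s\<bar>})) \<longlonglongrightarrow> 0"
  using assms(5,6)
proof (induction L)
  case empty
  obtain w where "w \<in> E" using strictly_positive by blast
  then have zero: "(\<lambda>t. 0) \<in> E"
    using ideal[of "\<lambda>t. 0" w] by (auto simp: L0_def)
  moreover have "N (\<lambda>t. 0) = 0"
    using norm_zero_iff[OF zero] by simp
  moreover have "indicator {} = (\<lambda>t::real. 0::ereal)"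
    by auto
  ultimately show ?case by simp
next
  case (insert a L)
  define B where "B A n = {s \<in> space (leb_I \<alpha>). \<exists>a\<in>A. \<bar>x s\<bar> < ereal a \<and> ereal a \<le> \<bar>X n s\<bar>}" for A n
  have x: "x \<in> E"
    using assms by (simp add: oc_point_def)
  have B1: "B {a} n = {s \<in> space (leb_I \<alpha>). \<bar>x s\<bar> < ereal a \<and> ereal a \<le> \<bar>X n s\<bar>}" for n
    by (simp add: B_def)
  have sets: "B A n \<in> sets (leb_I \<alpha>)" if "finite A" for A n
  proof -
    have "B A n = (\<Union>a\<in>A. {s \<in> space (leb_I \<alpha>). \<bar>x s\<bar> < ereal a \<and> ereal a \<le> \<bar>X n s\<bar>})"
      by (auto simp: B_def)
    also have "\<dots> \<in> sets (leb_I \<alpha>)"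
    proof (intro sets.finite_UN that)
      fix a show "{s \<in> space (leb_I \<alpha>). \<bar>x s\<bar> < ereal a \<and> ereal a \<le> \<bar>X n s\<bar>} \<in> sets (leb_I \<alpha>)"
        using x assms(2) by measurable
    qed
    finally show ?thesis .
  qed
  have IH: "\<And>n. indicator (B L n) \<in> E" "(\<lambda>n. N (indicator (B L n))) \<longlonglongrightarrow> 0"
    using insert by (auto simp: B_def)
  have single: "indicator (B {a} n) \<in> E" for n
    using insert.prems
    by (intro indicator_level_closed[OF assms(2), of a _ n] sets) (auto simp: B_def)
  have lim: "(\<lambda>n. N (indicator (B {a} n))) \<longlonglongrightarrow> 0"
    unfolding B1 using insert.prems by (intro level_separation_tendsto assms) auto
  have sub: "B (insert a L) n \<subseteq> B {a} n \<union> B L n" for n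
    by (auto simp: B_def)
  have le: "indicator (B (insert a L) n) \<in> E"
      "N (indicator (B (insert a L) n)) \<le> N (indicator (B {a} n)) + N (indicator (B L n))" for n
  proof -
    have "AE t in leb_I \<alpha>. t \<in> B (insert a L) n \<longrightarrow>
        1 \<le> \<bar>indicator (B {a} n) t\<bar> + \<bar>indicator (B L n) t :: ereal\<bar>"
      using sub[of n] by (intro AE_I2) (auto simp: indicator_def)
    from norm_indicator_le[OF single IH(1) sets this] insert.hyps
    show "indicator (B (insert a L) n) \<in> E"
      "N (indicator (B (insert a L) n)) \<le> N (indicator (B {a} n)) + N (indicator (B L n))"
      by auto
  qed
  have "(\<lambda>n. N (indicator (B {a} n)) + N (indicator (B L n))) \<longlonglongrightarrow> 0"
    using tendsto_add[OF lim IH(2)] by simp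
  then have "(\<lambda>n. N (indicator (B (insert a L) n))) \<longlonglongrightarrow> 0"
    by (rule tendsto_sandwich[OF _ _ tendsto_const, rotated 2]) (auto intro!: always_eventually le norm_nonneg)
  then show ?case
    using le(1) by (simp add: B_def)
qed

text \<open>\<open>grid_estimate\<close>, applied pointwise to \<open>\<bar>x t\<bar>\<close> and
  \<open>X n t\<close>, bounds the difference by functions whose norms are controlled by the
  rearrangement distance and by order continuity of \<open>x\<close>.\<close>

lemma norm_diff_tendsto_of_rearr:
  assumes oc: "oc_point \<alpha> E N x" and X: "\<And>n. X n \<in> E"
    and ge: "\<And>n. AE t in leb_I \<alpha>. \<bar>x t\<bar> \<le> X n t"
    and rearr: "(\<lambda>n::nat. N (\<lambda>t. decr_rearr \<alpha> x t - decr_rearr \<alpha> (X n) t)) \<longlonglongrightarrow> 0"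
  shows "(\<lambda>n. N (\<lambda>t. X n t - \<bar>x t\<bar>)) \<longlonglongrightarrow> 0"
proof (rule tendsto_0_nonnegI[where C = 8])
  have x: "x \<in> E"
    using assms by (simp add: oc_point_def)
  have H: "(\<lambda>t. X n t - \<bar>x t\<bar>) \<in> E" for n
    by (intro diff_closed abs_closed X x)
  then show "0 \<le> N (\<lambda>t. X n t - \<bar>x t\<bar>)" for n
    by (rule norm_nonneg)
  have ge': "AE t in leb_I \<alpha>. \<bar>x t\<bar> \<le> \<bar>X n t\<bar>" for n
    using ge[of n] by eventually_elim (rule ereal_abs_le_abs)
  \<comment> \<open>The bound \<open>8 * e\<close> collects \<open>2 * e\<close> from
    \<open>f1\<close>, \<open>4 * e\<close> from twice \<open>f2\<close> and \<open>2 * e\<close>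
    from \<open>F\<close>. The numbers \<open>\<eta>\<close>, \<open>K\<close>,
    \<open>\<delta>\<close> and the grid depend on \<open>x\<close> and \<open>e\<close> alone; only
    then is \<open>n\<close> taken large.\<close>
  fix e :: real assume e: "0 < e"
  obtain m where m: "N (\<lambda>t. min \<bar>x t\<bar> (ereal (1 / Suc m))) < e"
    using order_tendstoD(2)[OF oc_min_tendsto[OF oc] e] by (auto simp: eventually_sequentially)
  define \<eta> where "\<eta> = 1 / Suc m"
  obtain k0 where k0: "\<And>k. k \<ge> k0 \<Longrightarrow> N (\<lambda>t. max (\<bar>x t\<bar> - ereal (real k)) 0) < e"
    using order_tendstoD(2)[OF oc_excess_tendsto[OF oc] e] by (auto simp: eventually_sequentially)
  \<comment> \<open>The successor makes \<open>K\<close> positive, and \<open>K = 2 * real k\<close>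
    makes \<open>K / 2\<close> one of the levels in \<open>oc_excess_tendsto\<close>.\<close>
  define k where "k = Suc k0"
  define K where "K = 2 * real k"
  have K: "0 < K" "K / 2 = real k" "N (\<lambda>t. max (\<bar>x t\<bar> - ereal (K / 2)) 0) < e"
    using k0[of k] by (simp_all add: K_def k_def del: of_nat_Suc)
  \<comment> \<open>The summand \<open>1\<close> keeps the denominator positive when
    \<open>N x = 0\<close>.\<close>
  define \<delta> where "\<delta> = e / (N x + 1)"
  have Nx: "0 \<le> N x" using x by (rule norm_nonneg)
  have \<delta>: "0 < \<delta>" "\<delta> * N x \<le> e"
    using e Nx by (auto simp: \<delta>_def field_simps)
  have \<eta>: "0 < \<eta>" by (simp add: \<eta>_def)
  obtain J :: nat where "K / (\<delta> * \<eta>) \<le> real J"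
    using real_arch_simple by blast
  then have J: "K \<le> \<eta> + real J * (\<delta> * \<eta>)"
    using \<delta>(1) \<eta> by (simp add: field_simps)
  define L where "L = (\<lambda>j. \<eta> + real j * (\<delta> * \<eta>)) ` {..J}"
  define B where "B n = {s \<in> space (leb_I \<alpha>). \<exists>a\<in>L. \<bar>x s\<bar> < ereal a \<and> ereal a \<le> \<bar>X n s\<bar>}" for n
  have "finite L" "L \<subseteq> {0<..}"
    using \<delta>(1) \<eta> by (auto simp: L_def intro!: add_pos_nonneg)
  then have BE: "\<And>n. indicator (B n) \<in> E" and Blim: "(\<lambda>n. N (indicator (B n))) \<longlonglongrightarrow> 0"
    using level_separation_finite_tendsto[OF oc X ge' rearr] by (auto simp: B_def)
  have "eventually (\<lambda>n. N (indicator (B n)) < e / K) sequentially"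
    using order_tendstoD(2)[OF Blim, of "e / K"] e K(1) by simp
  moreover have "eventually (\<lambda>n. N (\<lambda>t. decr_rearr \<alpha> x t - decr_rearr \<alpha> (X n) t) < e) sequentially"
    by (rule order_tendstoD(2)[OF rearr e])
  ultimately show "eventually (\<lambda>n. N (\<lambda>t. X n t - \<bar>x t\<bar>) < 8 * e) sequentially"
  proof eventually_elim
    case (elim n)
    define f1 where "f1 = (\<lambda>t. min \<bar>X n t\<bar> (ereal \<eta>))"
    define f2 where "f2 = (\<lambda>t. max (\<bar>X n t\<bar> - ereal (K / 2)) 0)"
    define F where "F = (\<lambda>t. ereal \<delta> * \<bar>x t\<bar> + ereal K * indicator (B n) t)"
    have E: "f1 \<in> E" "f2 \<in> E" "F \<in> E"
      unfolding f1_def f2_def F_def using X x BE \<eta> K(1)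
      by (auto intro!: norm_min_decr_rearr norm_excess_decr_rearr add_closed scale_closed abs_closed)
    have "N (\<lambda>t. X n t - \<bar>x t\<bar>) \<le> N f1 + N (\<lambda>t. ereal 2 * f2 t + F t)"
    proof (rule norm_le_add(2)[OF E_measurable[OF H] E(1) add_closed[OF scale_closed[OF E(2)] E(3)]])
      show "AE t in leb_I \<alpha>. \<bar>X n t - \<bar>x t\<bar>\<bar> \<le> \<bar>f1 t\<bar> + \<bar>ereal 2 * f2 t + F t\<bar>"
        using AE_finite[OF X[of n]] AE_finite[OF x] ge[of n] AE_space
      proof eventually_elim
        case (elim t)
        obtain p q where pq: "x t = ereal p" "X n t = ereal q"
          using elim by (cases "x t"; cases "X n t") auto
        have le: "\<bar>p\<bar> \<le> q" using elim pq by simp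
        define b :: real where "b = of_bool (\<exists>a\<in>L. \<bar>p\<bar> < a \<and> a \<le> q)"
        have ind: "indicator (B n) t = ereal b"
          using elim le unfolding b_def B_def by (auto simp: pq indicator_def one_ereal_def zero_ereal_def)
        have "q - \<bar>p\<bar> \<le> min q \<eta> + (2 * max (q - K / 2) 0 + (\<delta> * \<bar>p\<bar> + K * b))"
          unfolding b_def L_def using le \<eta> \<delta>(1) K(1) J by (intro grid_estimate) auto
        then have "q - \<bar>p\<bar> \<le> \<bar>min q \<eta>\<bar> + \<bar>2 * max (q - K / 2) 0 + (\<delta> * \<bar>p\<bar> + K * b)\<bar>"
          by linarith
        moreover have "f1 t = ereal (min q \<eta>)" "f2 t = ereal (max (q - K / 2) 0)"
          using le by (auto simp: f1_def f2_def pq min_def max_def zero_ereal_def)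
        moreover have "F t = ereal (\<delta> * \<bar>p\<bar> + K * b)"
          by (simp add: F_def pq ind)
        moreover have "\<bar>q - \<bar>p\<bar>\<bar> = q - \<bar>p\<bar>"
          using le by simp
        ultimately show ?case
          by (simp add: pq del: ereal_min ereal_max)
      qed
    qed
    also have "N f1 \<le> N (\<lambda>t. decr_rearr \<alpha> x t - decr_rearr \<alpha> (X n) t) + N (\<lambda>t. min \<bar>x t\<bar> (ereal \<eta>))"
      unfolding f1_def using \<eta> by (intro norm_min_le x X) simp
    also have "N (\<lambda>t. ereal 2 * f2 t + F t) \<le> 2 * N f2 + N F"
      using norm_triangle[OF scale_closed[OF E(2), of 2] E(3)] norm_scale[OF E(2), of 2] by simp
    also have "N f2 \<le> N (\<lambda>t. decr_rearr \<alpha> x t - decr_rearr \<alpha> (X n) t) + N (\<lambda>t. max (\<bar>x t\<bar> - ereal (K / 2)) 0)"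
      unfolding f2_def using K(1) by (intro norm_excess_le x X) simp
    also have "N F \<le> \<delta> * N x + K * N (indicator (B n))"
      using norm_triangle[OF scale_closed[OF abs_closed[OF x], of \<delta>] scale_closed[OF BE[of n], of K]]
        norm_scale[OF abs_closed[OF x], of \<delta>] norm_scale[OF BE[of n], of K] \<delta>(1) K(1)
      by (simp add: F_def norm_abs[OF x])
    also have "K * N (indicator (B n)) < e"
      using elim(1) K(1) by (simp add: field_simps)
    finally show ?case
      using m[folded \<eta>_def] K(3) \<delta>(2) elim(2) by simp
  qed
qed simp

text \<open>Domination of \<open>\<bar>x\<bar>\<close> by \<open>X n\<close> implies
  \<open>x \<prec> X n\<close>, so the ULUKM property supplies the convergence of rearrangements
  that \<open>norm_diff_tendsto_of_rearr\<close> requires.\<close>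

lemma ulum_point_abs:
  assumes "oc_point \<alpha> E N x" "ulukm_point \<alpha> E N x"
  shows "ulum_point \<alpha> E N (\<lambda>t. \<bar>x t\<bar>)"
  unfolding ulum_point_def
proof (intro conjI allI impI)
  have x: "x \<in> E"
    using assms by (simp add: oc_point_def)
  then show "(\<lambda>t. \<bar>x t\<bar>) \<in> pos_cone \<alpha> E"
    by (simp add: pos_cone_def abs_closed)
  fix X :: "nat \<Rightarrow> real \<Rightarrow> ereal"
  assume "(\<forall>n. X n \<in> E) \<and> (\<forall>n. AE t in leb_I \<alpha>. \<bar>x t\<bar> \<le> X n t) \<and> (\<lambda>n. N (X n)) \<longlonglongrightarrow> N (\<lambda>t. \<bar>x t\<bar>)"
  then have X: "\<And>n. X n \<in> E" and ge: "\<And>n. AE t in leb_I \<alpha>. \<bar>x t\<bar> \<le> X n t"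
    and lim: "(\<lambda>n. N (X n)) \<longlonglongrightarrow> N x"
    by (auto simp: norm_abs[OF x])
  have "submajorized \<alpha> x (X n)" for n
    using ge[of n] by (intro submajorized_mono E_L0 X) (auto elim!: eventually_mono intro: ereal_abs_le_abs)
  then have "(\<lambda>n. N (\<lambda>t. decr_rearr \<alpha> x t - decr_rearr \<alpha> (X n) t)) \<longlonglongrightarrow> 0"
    using assms(2) X lim by (simp add: ulukm_point_def)
  then show "(\<lambda>n. N (\<lambda>t. X n t - \<bar>x t\<bar>)) \<longlonglongrightarrow> 0"
    by (rule norm_diff_tendsto_of_rearr[OF assms(1) X ge])
qed

section \<open>Convergence in measure and the \<open>H_g\<close> property\<close>

lemma hg_point_of_ulum:
  assumes "oc_point \<alpha> E N x" "ulum_point \<alpha> E N (\<lambda>t. \<bar>x t\<bar>)"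
  shows "hg_point \<alpha> E N x"
  unfolding hg_point_def
proof (intro conjI allI impI)
  show x: "x \<in> E"
    using assms by (simp add: oc_point_def)
  fix X :: "nat \<Rightarrow> real \<Rightarrow> ereal"
  assume "(\<forall>n. X n \<in> E) \<and> converges_globally_in_measure \<alpha> X x \<and> (\<lambda>n. N (X n)) \<longlonglongrightarrow> N x"
  then have X: "\<And>n. X n \<in> E" and conv: "converges_globally_in_measure \<alpha> X x"
    and lim: "(\<lambda>n. N (X n)) \<longlonglongrightarrow> N x"
    by auto
  \<comment> \<open>\<open>Y n\<close> records how far \<open>\<bar>X n\<bar>\<close> falls short of
    \<open>\<bar>x\<bar>\<close>, \<open>V n - \<bar>x\<bar>\<close> how far it exceeds it, and
    \<open>W n\<close> compensates for opposite signs. Both \<open>Y n\<close> and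
    \<open>W n\<close> are bounded by \<open>\<bar>x\<bar>\<close> and by
    \<open>\<bar>X n - x\<bar>\<close>, so order continuity handles them.\<close>
  define Y where "Y n = (\<lambda>t. max (\<bar>x t\<bar> - \<bar>X n t\<bar>) 0)" for n
  define W where "W n = (\<lambda>t. min \<bar>x t\<bar> \<bar>X n t - x t\<bar>)" for n
  define V where "V n = (\<lambda>t. max \<bar>X n t\<bar> \<bar>x t\<bar>)" for n
  have D: "(\<lambda>t. X n t - x t) \<in> E" for n
    by (intro diff_closed X x)
  have WE: "W n \<in> E" for n
    unfolding W_def by (intro inf_closed abs_closed D x)
  have VE: "V n \<in> E" for n
    unfolding V_def by (intro sup_closed abs_closed X x)
  have Y_meas: "Y n \<in> borel_measurable (leb_I \<alpha>)" for n
    unfolding Y_def using X x by measurable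
  have Y_bounds: "AE t in leb_I \<alpha>. 0 \<le> Y n t \<and> Y n t \<le> \<bar>x t\<bar> \<and> Y n t \<le> \<bar>X n t - x t\<bar>" for n
    using AE_finite[OF X[of n]] AE_finite[OF x]
  proof eventually_elim
    case (elim t)
    then show ?case
      by (cases "x t"; cases "X n t") (auto simp: Y_def max_def zero_ereal_def)
  qed
  have YE: "Y n \<in> E" for n
  proof (rule ideal[THEN conjunct1, OF _ x])
    show "AE t in leb_I \<alpha>. \<bar>Y n t\<bar> \<le> \<bar>x t\<bar>"
      using Y_bounds[of n] by eventually_elim (simp add: abs_ereal_ge0)
  qed (use Y_meas in \<open>simp add: L0_def\<close>)
  have measure: "(\<lambda>n. emeasure (leb_I \<alpha>) {t \<in> space (leb_I \<alpha>). ereal e < \<bar>X n t - x t\<bar>}) \<longlonglongrightarrow> 0"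
    if "0 < e" for e
    using conv that by (simp add: converges_globally_in_measure_def)
  have Ylim: "(\<lambda>n. N (Y n)) \<longlonglongrightarrow> 0"
    by (rule oc_dominated_in_measure[OF assms(1) Y_meas E_measurable[OF D] Y_bounds measure])
  have Wlim: "(\<lambda>n. N (W n)) \<longlonglongrightarrow> 0"
    by (rule oc_dominated_in_measure[OF assms(1) E_measurable[OF WE] E_measurable[OF D] _ measure])
      (auto simp: W_def)
  have upper: "N (V n) \<le> N (X n) + N (Y n)" for n
  proof (rule norm_le_add(2)[OF E_measurable[OF VE] X YE])
    show "AE t in leb_I \<alpha>. \<bar>V n t\<bar> \<le> \<bar>X n t\<bar> + \<bar>Y n t\<bar>"
      using AE_finite[OF X[of n]] AE_finite[OF x]
    proof eventually_elim
      case (elim t)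
      then show ?case
        by (cases "x t"; cases "X n t") (auto simp: Y_def V_def max_def zero_ereal_def)
    qed
  qed
  have lower: "N x \<le> N (V n)" for n
  proof (rule ideal[THEN conjunct2, OF E_L0[OF x] VE])
    show "AE t in leb_I \<alpha>. \<bar>x t\<bar> \<le> \<bar>V n t\<bar>"
      by (intro AE_I2 ereal_abs_le_abs) (simp add: V_def)
  qed
  have "(\<lambda>n. N (V n)) \<longlonglongrightarrow> N x"
  proof (rule tendsto_sandwich[OF _ _ tendsto_const])
    show "(\<lambda>n. N (X n) + N (Y n)) \<longlonglongrightarrow> N x"
      using tendsto_add[OF lim Ylim] by simp
  qed (use upper lower in auto)
  moreover have "AE t in leb_I \<alpha>. \<bar>x t\<bar> \<le> V n t" for n
    by (simp add: V_def)
  ultimately have Vlim: "(\<lambda>n. N (\<lambda>t. V n t - \<bar>x t\<bar>)) \<longlonglongrightarrow> 0"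
    using assms(2) VE by (simp add: ulum_point_def norm_abs[OF x])
  have VxE: "(\<lambda>t. V n t - \<bar>x t\<bar>) \<in> E" for n
    by (intro diff_closed abs_closed VE x)
  have bound: "N (\<lambda>t. X n t - x t) \<le> N (\<lambda>t. V n t - \<bar>x t\<bar>) + (N (Y n) + 2 * N (W n))" for n
  proof -
    have "N (\<lambda>t. X n t - x t) \<le> N (\<lambda>t. V n t - \<bar>x t\<bar>) + N (\<lambda>t. Y n t + ereal 2 * W n t)"
    proof (rule norm_le_add(2)[OF E_measurable[OF D] VxE add_closed[OF YE scale_closed[OF WE]]])
      show "AE t in leb_I \<alpha>. \<bar>X n t - x t\<bar> \<le> \<bar>V n t - \<bar>x t\<bar>\<bar> + \<bar>Y n t + ereal 2 * W n t\<bar>"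
        using AE_finite[OF X[of n]] AE_finite[OF x]
      proof eventually_elim
        case (elim t)
        obtain p q where pq: "x t = ereal p" "X n t = ereal q"
          using elim by (cases "x t"; cases "X n t") auto
        have "V n t = ereal (max \<bar>q\<bar> \<bar>p\<bar>)" "W n t = ereal (min \<bar>p\<bar> \<bar>q - p\<bar>)"
          "Y n t = ereal (max (\<bar>p\<bar> - \<bar>q\<bar>) 0)"
          by (auto simp: V_def W_def Y_def pq max_def min_def zero_ereal_def)
        \<comment> \<open>The first two terms add up to
          \<open>\<bar>\<bar>q\<bar> - \<bar>p\<bar>\<bar>\<close>, which settles equal signs. For
          opposite signs the left side is larger than this by
          \<open>2 * min \<bar>p\<bar> \<bar>q\<bar>\<close>, and the minimum on the right equals
          \<open>\<bar>p\<bar>\<close>; hence the factor 2.\<close>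
        moreover have "\<bar>q - p\<bar> \<le> \<bar>max \<bar>q\<bar> \<bar>p\<bar> - \<bar>p\<bar>\<bar> + \<bar>max (\<bar>p\<bar> - \<bar>q\<bar>) 0 + 2 * min \<bar>p\<bar> \<bar>q - p\<bar>\<bar>"
          by (auto simp: max_def min_def abs_if)
        ultimately show ?case
          by (simp add: pq del: ereal_min ereal_max)
      qed
    qed
    moreover have "N (\<lambda>t. Y n t + ereal 2 * W n t) \<le> N (Y n) + 2 * N (W n)"
      using norm_triangle[OF YE scale_closed[OF WE], of n 2 n] norm_scale[OF WE, of 2 n] by simp
    ultimately show ?thesis by simp
  qed
  have "(\<lambda>n. N (\<lambda>t. V n t - \<bar>x t\<bar>) + (N (Y n) + 2 * N (W n))) \<longlonglongrightarrow> 0 + (0 + 2 * 0)"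
    by (intro tendsto_intros Vlim Ylim Wlim)
  then have sum: "(\<lambda>n. N (\<lambda>t. V n t - \<bar>x t\<bar>) + (N (Y n) + 2 * N (W n))) \<longlonglongrightarrow> 0"
    by simp
  show "(\<lambda>n. N (\<lambda>t. X n t - x t)) \<longlonglongrightarrow> 0"
    by (rule tendsto_sandwich[OF _ _ tendsto_const sum]) (use bound norm_nonneg[OF D] in auto)
qed

end

theorem theorem3p14:
  fixes \<alpha> :: ereal and E :: "(real \<Rightarrow> ereal) set" and N :: "(real \<Rightarrow> ereal) \<Rightarrow> real"
    and x :: "real \<Rightarrow> ereal"
  assumes "symmetric_space \<alpha> E N"
    and "fatou_property \<alpha> E N"
    and "x \<in> E"
    and "oc_point \<alpha> E N x"
    and "ulukm_point \<alpha> E N x"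
  shows "ulum_point \<alpha> E N (\<lambda>t. \<bar>x t\<bar>) \<and> hg_point \<alpha> E N x"
  using symmetric_space.ulum_point_abs[OF assms(1,4,5)]
    symmetric_space.hg_point_of_ulum[OF assms(1,4)] by blast

end
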